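(* Let $(X,Y)$ follow the inverted max-stable distribution with unit exponential margins associated with a spectral measure $H$ with lower and upper end points $w_\ell\in[0,1/2)$ and $w_u\in(1/2,1]$. Assume that, apart from possible point masses $H(\{w_\ell\}),H(\{w_u\})\ge 0$ at $w_\ell$ and $w_u$, $H$ is absolutely continuous with respect to Lebesgue measure, with density $h$ satisfying $$h(w)\sim \mathcal{L}(w-w_\ell)\,(w-w_\ell)^{t}\qquad\text{as } w\downarrow w_\ell,$$ where $t>-1$ and $\mathcal{L}$ is slowly varying at $0^+$. Then the limit $$\lim_{u\to\infty}\Pr\left\{X-u>x,\ \frac{Y-a(X)}{b(X)}<z\ \Big|\ X>u\right\}=\exp(-x)\,G(z),\qquad x>0,$$ holds as follows. (i) If $H(\{w_\ell\})=0$ and $$\lim_{w\to 0^+}\frac{\mathcal{L}\{w\,\mathcal{L}(w)^{-\tau}\}}{\mathcal{L}(w)}=1\qquad\text{for all }\tau\in(0,1),$$ then the limit holds with $a(x)=\{w_\ell/(1-w_\ell)\}x$, $b(x)=x^{(t+1)/(t+2)}\,\mathcal{L}\{x^{-1/(t+2)}\}^{-1/(t+2)}$ for $x>0$, and $$G(z)=1-\exp\left\{-\frac{(1-w_\ell)^{3+2t}\,z^{t+2}}{(t+1)(t+2)}\right\}\qquad\text{for } z>0.$$ (ii) If $H(\{w_\ell\})>0$, then the limit holds with $a(x)=\{w_\ell/(1-w_\ell)\}x$, $b(x)=1$ for $x>0$, and $$G(z)=1-\{1-w_\ell H(\{w_\ell\})\}\exp\left\{-(1-w_\ell)H(\{w_\ell\})\,z\right\}\qquad\text{for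 } z>0,$$ and $G(z)=0$ for $z<0$, so that $G$ has an atom at $0$ of mass $w_\ell H(\{w_\ell\})$.
   Context: A spectral measure is a finite Borel measure $H$ on $[0,1]$ with total mass $2$ and $\int_0^1 w\,\mathrm{d}H(w)=1$. Its exponent measure is $V(x,y)=\int_0^1\max\{w/x,(1-w)/y\}\,\mathrm{d}H(w)$ for $x,y>0$. The associated inverted max-stable distribution with unit exponential margins is the law of the pair $(X,Y)$ of positive random variables with $\Pr(X>x,Y>y)=\exp\{-V(1/x,1/y)\}$ for $x,y>0$. The lower and upper end points $w_\ell,w_u$ of $H$ are the infimum and supremum of the support of $H$; the case of perfect dependence $w_\ell=w_u=1/2$ is excluded, so $w_\ell\in[0,1/2)$ and $w_u\in(1/2,1]$. A function $\mathcal{L}$, positive on a right neighbourhood of $0$, is slowly varying at $0^+$ if $\lim_{s\to0^+}\mathcal{L}(sw)/\mathcal{L}(s)=1$ for all $w>0$. The function $G$ in the limit is a non-degenerate distribution function on $\mathbb{R}$ with $\lim_{z\to\infty}G(z)=1$. *)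

theory Defs
  imports "HOL-Probability.Probability" "HOL-Library.Landau_Symbols"
begin

text \<open>A measure on \<open>[0,1]\<close> is represented as a Borel measure on the real line that is
  carried by \<open>[0,1]\<close>.\<close>

definition spectral_measure :: "real measure \<Rightarrow> bool" where
  "spectral_measure H \<longleftrightarrow>
     sets H = sets borel \<and> finite_measure H \<and> emeasure H (- {0..1}) = 0 \<and>
     measure H {0..1} = 2 \<and> (LINT w|H. w) = 1"

definition measure_support :: "real measure \<Rightarrow> real set" where
  "measure_support H = {w. \<forall>U. open U \<longrightarrow> w \<in> U \<longrightarrow> emeasure H U > 0}"

definition lower_end_point :: "real measure \<Rightarrow> real" where
  "lower_end_point H = Inf (measure_support H)"

definition upper_end_point :: "real measure \<Rightarrow> real" where
  "upper_end_point H = Sup (measure_support H)"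

definition exponent_measure :: "real measure \<Rightarrow> real \<Rightarrow> real \<Rightarrow> real" where
  "exponent_measure H x y = (LINT w|H. max (w / x) ((1 - w) / y))"

definition inverted_max_stable ::
    "real measure \<Rightarrow> 'a measure \<Rightarrow> ('a \<Rightarrow> real) \<Rightarrow> ('a \<Rightarrow> real) \<Rightarrow> bool" where
  "inverted_max_stable H M X Y \<longleftrightarrow>
     X \<in> borel_measurable M \<and> Y \<in> borel_measurable M \<and>
     (AE \<omega> in M. X \<omega> > 0 \<and> Y \<omega> > 0) \<and>
     (\<forall>x>0. \<forall>y>0. \<P>(\<omega> in M. X \<omega> > x \<and> Y \<omega> > y) = exp (- exponent_measure H (1 / x) (1 / y)))"

definition slowly_varying_at_0 :: "(real \<Rightarrow> real) \<Rightarrow> bool" where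
  "slowly_varying_at_0 L \<longleftrightarrow>
     (\<forall>\<^sub>F s in at_right 0. L s > 0) \<and>
     (\<forall>w>0. ((\<lambda>s. L (s * w) / L s) \<longlongrightarrow> 1) (at_right 0))"

text \<open>Off the points of \<open>P\<close>, the measure \<open>H\<close> has Lebesgue density \<open>h\<close>; on \<open>P\<close> it is
  unrestricted.\<close>

definition has_density_off :: "real set \<Rightarrow> real measure \<Rightarrow> (real \<Rightarrow> real) \<Rightarrow> bool" where
  "has_density_off P H h \<longleftrightarrow>
     h \<in> borel_measurable borel \<and> (\<forall>w. h w \<ge> 0) \<and>
     density H (indicator (- P)) = density lborel (\<lambda>w. ennreal (h w))"

text \<open>Distribution functions on the real line are the functions \<open>cdf \<mu>\<close> with \<open>\<mu>\<close> a
  \<open>real_distribution\<close>; they automatically tend to \<open>1\<close> at infinity.\<close>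

definition nondegenerate :: "real measure \<Rightarrow> bool" where
  "nondegenerate \<mu> \<longleftrightarrow> (\<forall>c. measure \<mu> {c} \<noteq> 1)"

text \<open>The limit is required at every continuity point \<open>z\<close> of \<open>G\<close>. At an atom it can fail:
  if \<open>G\<close> has an atom at \<open>0\<close> and \<open>Y \<ge> a X\<close> almost surely, then the probabilities on the
  left are \<open>0\<close> at \<open>z = 0\<close>, whereas \<open>G 0 > 0\<close>.\<close>

definition conditional_limit ::
    "'a measure \<Rightarrow> ('a \<Rightarrow> real) \<Rightarrow> ('a \<Rightarrow> real) \<Rightarrow> (real \<Rightarrow> real) \<Rightarrow> (real \<Rightarrow> real) \<Rightarrow>
     (real \<Rightarrow> real) \<Rightarrow> bool" where
  "conditional_limit M X Y a b G \<longleftrightarrow>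
     (\<forall>x>0. \<forall>z. isCont G z \<longrightarrow>
        ((\<lambda>u. \<P>(\<omega> in M. X \<omega> - u > x \<and> (Y \<omega> - a (X \<omega>)) / b (X \<omega>) < z \<bar> X \<omega> > u))
           \<longlongrightarrow> exp (- x) * G z) at_top)"

end

theory Submission
  imports Defs "HOL-Real_Asymp.Real_Asymp"
begin

text \<open>
  Write \<open>w\<^sub>0\<close> for the lower end point of \<open>H\<close>, \<open>c = w\<^sub>0 / (1 - w\<^sub>0)\<close>, and
  \<open>\<psi> x y = \<integral> max 0 ((1 - w) y - w x) dH(w)\<close>, which is called \<open>excess H x y\<close> below. Splitting the
  maximum in the exponent measure gives \<open>P(X > x, Y > y) = exp (- x - \<psi> x y)\<close>
  (\<open>joint_survival\<close>), so \<open>X\<close> is unit exponential and \<open>\<psi>\<close> carries all the dependence.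
  On the line \<open>y = c x + \<zeta>\<close> the integrand of \<open>\<psi>\<close> equals
  \<open>max 0 ((1 - w) \<zeta> - (w - w\<^sub>0) x / (1 - w\<^sub>0))\<close>, so that for large \<open>x\<close> only those \<open>w\<close> count whose
  distance from \<open>w\<^sub>0\<close> is of order \<open>\<zeta> / x\<close>: the behaviour of \<open>H\<close> at its lower end point decides
  both the norming and the limit.

  With an atom of mass \<open>p\<close> at \<open>w\<^sub>0\<close>, dominated convergence gives
  \<open>\<psi> x (c x + \<zeta>) \<longrightarrow> (1 - w\<^sub>0) p max 0 \<zeta>\<close> (\<open>excess_limit_atom\<close>), and no scaling is needed.
  Without an atom the same integral is a Karamata integral of the density over a window of width
  \<open>S \<approx> (1 - w\<^sub>0)\<^sup>2 \<zeta> / x\<close>, hence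
  \<open>\<psi> x (c x + \<zeta>) \<sim> x / (1 - w\<^sub>0) L(S) S powr (t + 2) / ((t + 1) (t + 2))\<close> (\<open>karamata_weighted\<close>,
  \<open>excess_eq_density_integral\<close>). For \<open>\<zeta> = z b(x)\<close> the norming \<open>b\<close> is chosen to make this bounded,
  with \<open>L\<close> taken at \<open>x powr (- 1 / (t + 2))\<close> where the formula has \<open>L(S)\<close>; the condition on
  \<open>L(w L(w) powr (- \<tau>))\<close> at \<open>\<tau> = 1 / (t + 2)\<close> says precisely that the two values of \<open>L\<close> are
  asymptotically equal (\<open>excess_limit_regular\<close>).

  To pass from rectangles to the region above the curve \<open>y = a(x) + z b(x)\<close>, cut the half plane
  \<open>x > v\<close> into vertical strips of a fixed width \<open>\<epsilon>\<close>. In a strip the curve lies between two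
  horizontal levels, and the probability above a level is a difference of two values of the joint
  survival function. If these probabilities are close to \<open>q (1 - exp (- \<epsilon>)) exp (- v)\<close>, then the whole
  region has probability close to \<open>q exp (- v)\<close>, since the strips form a geometric series
  (\<open>survival_above_curve\<close>). Without an atom \<open>\<epsilon> = 1\<close> will do, because \<open>b\<close> tends to infinity and is
  nearly constant on unit intervals (\<open>norming_locally_constant\<close>, which rests on a Potter bound for
  slowly varying functions). With an atom the variation \<open>c \<epsilon>\<close> of the curve inside a strip is
  comparable to \<open>b = 1\<close>; letting \<open>\<epsilon> \<longrightarrow> 0\<close> turns it into the factor \<open>1 - w\<^sub>0 p\<close>, which is how the
  atom of the limit at \<open>0\<close> arises.
\<close>

section \<open>Functions slowly varying at 0\<close>

text \<open>Uniform convergence comes from averaging: \<open>d x u = min 1 \<bar>f (x + u) - f x\<bar>\<close> obeys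
  \<open>d x u \<le> d x s + d (x + u) (s - u)\<close>, and integrating over \<open>s \<in> {1..2}\<close> bounds it by
  \<open>E x + E (x + u)\<close>, where \<open>E x = \<integral>\<^sub>0\<^sup>2 d x\<close> does not depend on \<open>u\<close> and vanishes in the limit by
  dominated convergence. The truncation at \<open>1\<close> provides the dominating function.\<close>

lemma additive_uniform:
  fixes f :: "real \<Rightarrow> real"
  assumes [measurable]: "f \<in> borel_measurable borel"
    and lim: "\<And>u. u \<ge> 0 \<Longrightarrow> ((\<lambda>x. f (x + u) - f x) \<longlongrightarrow> 0) at_top"
    and "\<eta> > 0"
  shows "\<exists>N. \<forall>x\<ge>N. \<forall>u\<in>{0..1}. \<bar>f (x + u) - f x\<bar> < \<eta>"
proof -
  define d where "d = (\<lambda>x u. min 1 \<bar>f (x + u) - f x\<bar>)"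
  define E where "E = (\<lambda>x. LINT u|lborel. indicator {0..2} u * d x u)"
  have d_meas [measurable]: "d x \<in> borel_measurable borel" for x
    unfolding d_def by measurable
  have d_bounds: "0 \<le> d x u" "d x u \<le> 1" for x u
    by (auto simp: d_def)
  have int: "integrable lborel (\<lambda>u. indicator {a..b} u * d x (u + k))" for a b k x :: real
  proof (rule Bochner_Integration.integrable_bound[where f = "indicator {a..b} :: real \<Rightarrow> real"])
    show "AE u in lborel. norm (indicator {a..b} u * d x (u + k)) \<le> norm (indicator {a..b} u :: real)"
      using d_bounds[of x] by (intro AE_I2) (auto simp: indicator_def)
  qed (auto intro!: integrable_real_indicator simp: emeasure_lborel_Icc_eq)
  have E_lim: "(E \<longlongrightarrow> 0) at_top"
  proof -
    have "((\<lambda>x. LINT u|lborel. indicator {0..2} u * d x u) \<longlongrightarrow> (LINT (u::real)|lborel. 0)) at_top"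
    proof (rule integral_dominated_convergence_at_top[where w = "indicator {0..2::real} :: real \<Rightarrow> real"])
      show "AE u in lborel. ((\<lambda>x. indicator {0..2} u * d x u) \<longlongrightarrow> 0) at_top"
      proof (intro AE_I2)
        fix u :: real
        show "((\<lambda>x. indicator {0..2} u * d x u) \<longlongrightarrow> 0) at_top"
        proof (cases "u \<in> {0..2}")
          case True
          have "((\<lambda>x. min 1 \<bar>f (x + u) - f x\<bar>) \<longlongrightarrow> min 1 \<bar>0\<bar>) at_top"
            using True by (intro tendsto_min tendsto_rabs lim tendsto_const) auto
          thus ?thesis using True by (simp add: d_def)
        qed auto
      qed
      show "\<forall>\<^sub>F x in at_top. AE u in lborel. norm (indicator {0..2} u * d x u) \<le> indicator {0..2} u"
        using d_bounds by (intro always_eventually allI AE_I2) (auto simp: indicator_def)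
    qed (auto intro!: integrable_real_indicator simp: emeasure_lborel_Icc_eq)
    thus ?thesis by (simp add: E_def)
  qed
  have key: "d x u \<le> E x + E (x + u)" if u: "u \<in> {0..1}" for x u
  proof -
    have tri: "d x u \<le> d x s + d (x + u) (s - u)" for s
      unfolding d_def by (auto simp: min_def abs_if split: if_splits)
    have "d x u = (LINT s|lborel. indicator {1..2::real} s * d x u)"
      by simp
    also have "\<dots> \<le> (LINT s|lborel. indicator {1..2} s * d x s + indicator {1..2} s * d (x + u) (s - u))"
    proof (rule integral_mono)
      show "integrable lborel (\<lambda>s. indicator {1..2::real} s * d x u)"
        by simp
      show "integrable lborel (\<lambda>s. indicator {1..2} s * d x s + indicator {1..2} s * d (x + u) (s - u))"
        using int[of 1 2 x 0] int[of 1 2 "x + u" "-u"] by simp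
      show "indicator {1..2} s * d x u \<le>
          indicator {1..2} s * d x s + indicator {1..2} s * d (x + u) (s - u)" for s
        using tri[of s] by (auto simp: indicator_def)
    qed
    also have "\<dots> = (LINT s|lborel. indicator {1..2} s * d x s) +
        (LINT s|lborel. indicator {1..2} s * d (x + u) (s - u))"
      using int[of 1 2 x 0] int[of 1 2 "x + u" "-u"] by (intro Bochner_Integration.integral_add) simp_all
    \<comment> \<open>The range \<open>{1..2}\<close> of \<open>s\<close> keeps both \<open>s\<close> and \<open>s - u\<close> inside \<open>{0..2}\<close>.\<close>
    also have "(LINT s|lborel. indicator {1..2} s * d x s) \<le> E x"
      unfolding E_def
      using int[of 1 2 x 0] int[of 0 2 x 0]
      by (intro integral_mono) (auto simp: indicator_def d_bounds)
    also have "(LINT s|lborel. indicator {1..2} s * d (x + u) (s - u)) =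
        (LINT s|lborel. indicator {1..2} (u + s) * d (x + u) s)"
      by (subst lborel_integral_real_affine[where c = 1 and t = u]) simp_all
    also have "\<dots> = (LINT s|lborel. indicator {1-u..2-u} s * d (x + u) s)"
      by (intro Bochner_Integration.integral_cong) (auto simp: indicator_def)
    also have "\<dots> \<le> E (x + u)"
      unfolding E_def
      using int[of "1-u" "2-u" "x+u" 0] int[of 0 2 "x+u" 0] u
      by (intro integral_mono) (auto simp: indicator_def d_bounds)
    finally show ?thesis by simp
  qed
  define \<epsilon> where "\<epsilon> = min 1 \<eta> / 2"
  have "\<epsilon> > 0" using \<open>\<eta> > 0\<close> by (simp add: \<epsilon>_def)
  with E_lim obtain N where N: "\<And>x. x \<ge> N \<Longrightarrow> E x < \<epsilon>"
    by (metis order_tendstoD(2) eventually_at_top_linorder)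
  have "\<bar>f (x + u) - f x\<bar> < \<eta>" if "x \<ge> N" "u \<in> {0..1}" for x u
  proof -
    have "d x u < min 1 \<eta>"
      using key[OF that(2), of x] N[of x] N[of "x + u"] that by (auto simp: \<epsilon>_def)
    thus ?thesis by (auto simp: d_def min_def split: if_splits)
  qed
  thus ?thesis by blast
qed

text \<open>Cover the distance \<open>u\<close> by unit steps, each of which costs at most \<open>\<delta>\<close> by uniform convergence.\<close>

lemma additive_potter:
  fixes f :: "real \<Rightarrow> real"
  assumes "f \<in> borel_measurable borel"
    and "\<And>u. u \<ge> 0 \<Longrightarrow> ((\<lambda>x. f (x + u) - f x) \<longlongrightarrow> 0) at_top"
    and "\<delta> > 0"
  shows "\<exists>N. \<forall>x\<ge>N. \<forall>u\<ge>0. \<bar>f (x + u) - f x\<bar> \<le> \<delta> * (1 + u)"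
proof -
  obtain N where N: "\<And>x u. x \<ge> N \<Longrightarrow> u \<in> {0..1} \<Longrightarrow> \<bar>f (x + u) - f x\<bar> < \<delta>"
    using additive_uniform[OF assms] by blast
  have steps: "\<bar>f (x + u) - f x\<bar> \<le> \<delta> * real (Suc n)"
    if "x \<ge> N" "0 \<le> u" "u \<le> real (Suc n)" for x u n
    using that
  proof (induction n arbitrary: x u)
    case 0
    thus ?case using N[of x u] by auto
  next
    case (Suc n)
    show ?case
    proof (cases "u \<le> 1")
      case True
      have "\<delta> * 1 \<le> \<delta> * real (Suc (Suc n))"
        using \<open>\<delta> > 0\<close> by (intro mult_left_mono) auto
      thus ?thesis using N[of x u] Suc.prems True by auto
    next
      case False
      have "\<bar>f ((x + 1) + (u - 1)) - f (x + 1)\<bar> \<le> \<delta> * real (Suc n)"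
        using Suc.prems False by (intro Suc.IH) auto
      moreover have "\<bar>f (x + 1) - f x\<bar> < \<delta>"
        using N[of x 1] Suc.prems by auto
      ultimately show ?thesis by (simp add: algebra_simps)
    qed
  qed
  have "\<bar>f (x + u) - f x\<bar> \<le> \<delta> * (1 + u)" if "x \<ge> N" "u \<ge> 0" for x u
  proof -
    define n where "n = nat \<lfloor>u\<rfloor>"
    have n: "real n \<le> u" "u \<le> real (Suc n)"
      using that(2) unfolding n_def by linarith+
    have "\<bar>f (x + u) - f x\<bar> \<le> \<delta> * real (Suc n)"
      using that n by (intro steps)
    also have "\<dots> \<le> \<delta> * (1 + u)"
      using n \<open>\<delta> > 0\<close> by (intro mult_left_mono) auto
    finally show ?thesis .
  qed
  thus ?thesis by blast
qed

lemma slowly_varying_pos: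
  "slowly_varying_at_0 L \<Longrightarrow> \<forall>\<^sub>F s in at_right 0. L s > 0"
  by (simp add: slowly_varying_at_0_def)

text \<open>Potter's bound in logarithmic form: \<open>f x = ln (L (exp (- x)))\<close> turns slow variation at \<open>0\<close> into
  the additive property at infinity.\<close>

lemma slowly_varying_potter:
  fixes L :: "real \<Rightarrow> real"
  assumes L: "slowly_varying_at_0 L"
    and meas: "L \<in> borel_measurable (restrict_space borel {0<..<\<delta>\<^sub>0})" and "\<delta>\<^sub>0 > 0"
    and "\<delta> > 0"
  obtains s\<^sub>0 where "s\<^sub>0 > 0" and "\<And>s. 0 < s \<Longrightarrow> s \<le> s\<^sub>0 \<Longrightarrow> L s > 0"
    and "\<And>s s'. 0 < s' \<Longrightarrow> s' \<le> s \<Longrightarrow> s \<le> s\<^sub>0 \<Longrightarrow> \<bar>ln (L s') - ln (L s)\<bar> \<le> \<delta> * (1 + ln (s / s'))"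
proof -
  obtain b where b: "b > 0" "\<And>s. 0 < s \<Longrightarrow> s < b \<Longrightarrow> L s > 0"
    using L unfolding slowly_varying_at_0_def eventually_at_right_field by auto
  define c where "c = min b \<delta>\<^sub>0"
  have c: "c > 0" "\<And>s. 0 < s \<Longrightarrow> s < c \<Longrightarrow> L s > 0"
    using b \<open>\<delta>\<^sub>0 > 0\<close> by (auto simp: c_def)
  \<comment> \<open>Near \<open>0\<close> nothing changes, but now the function is Borel on the whole line.\<close>
  define L' where "L' = (\<lambda>s. indicator {0<..<c} s *\<^sub>R L s)"
  have [measurable]: "L' \<in> borel_measurable borel"
  proof -
    have "(\<lambda>s. indicator {0<..<\<delta>\<^sub>0} s *\<^sub>R L s) \<in> borel_measurable borel"
      using meas by (subst (asm) borel_measurable_restrict_space_iff) auto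
    hence "(\<lambda>s. indicator {0<..<c} s *\<^sub>R (indicator {0<..<\<delta>\<^sub>0} s *\<^sub>R L s)) \<in> borel_measurable borel"
      by measurable
    also have "(\<lambda>s. indicator {0<..<c} s *\<^sub>R (indicator {0<..<\<delta>\<^sub>0} s *\<^sub>R L s)) = L'"
      by (auto simp: L'_def c_def indicator_def)
    finally show ?thesis .
  qed
  define f where "f = (\<lambda>x. ln (L' (exp (- x))))"
  have f_eq: "f x = ln (L (exp (- x)))" if "x > - ln c" for x
  proof -
    have "exp (- x) < c"
      using that c(1) by (metis exp_less_cancel_iff exp_ln minus_less_iff)
    thus ?thesis by (simp add: f_def L'_def)
  qed
  have "((\<lambda>x. f (x + u) - f x) \<longlongrightarrow> 0) at_top" if "u \<ge> 0" for u
  proof -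
    have "((\<lambda>s. L (s * exp (- u)) / L s) \<longlongrightarrow> 1) (at_right 0)"
      using L by (auto simp: slowly_varying_at_0_def)
    moreover have "filterlim (\<lambda>x::real. exp (- x)) (at_right 0) at_top"
      by (auto simp: filterlim_at intro!: filterlim_compose[OF exp_at_bot] filterlim_uminus_at_bot_at_top)
    ultimately have "((\<lambda>x. L (exp (- x) * exp (- u)) / L (exp (- x))) \<longlongrightarrow> 1) at_top"
      by (rule filterlim_compose)
    hence "((\<lambda>x. ln (L (exp (- x) * exp (- u)) / L (exp (- x)))) \<longlongrightarrow> ln 1) at_top"
      by (intro tendsto_ln) auto
    moreover have "\<forall>\<^sub>F x in at_top. ln (L (exp (- x) * exp (- u)) / L (exp (- x))) = f (x + u) - f x"
      using eventually_gt_at_top[of "- ln c"]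
    proof eventually_elim
      case (elim x)
      have "exp (- x) < c"
        using elim c(1) by (metis exp_less_cancel_iff exp_ln minus_less_iff)
      moreover have "exp (- (x + u)) \<le> exp (- x)" using \<open>u \<ge> 0\<close> by simp
      ultimately have "exp (- x) < c" "exp (- (x + u)) < c" by linarith+
      hence "L (exp (- x)) > 0" "L (exp (- (x + u))) > 0"
        using c(2) by simp_all
      thus ?case using elim \<open>u \<ge> 0\<close> by (simp add: f_eq ln_div exp_add[symmetric])
    qed
    ultimately show ?thesis by (simp add: tendsto_cong)
  qed
  moreover have "f \<in> borel_measurable borel" unfolding f_def by measurable
  ultimately obtain N where N: "\<And>x u. x \<ge> N \<Longrightarrow> u \<ge> 0 \<Longrightarrow> \<bar>f (x + u) - f x\<bar> \<le> \<delta> * (1 + u)"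
    using additive_potter[of f, OF _ _ \<open>\<delta> > 0\<close>] by blast
  define s\<^sub>0 where "s\<^sub>0 = min (exp (- N)) (c / 2)"
  show ?thesis
  proof (rule that)
    show "s\<^sub>0 > 0" using c by (simp add: s\<^sub>0_def)
    show "L s > 0" if "0 < s" "s \<le> s\<^sub>0" for s
      using that c by (auto simp: s\<^sub>0_def)
    show "\<bar>ln (L s') - ln (L s)\<bar> \<le> \<delta> * (1 + ln (s / s'))" if s: "0 < s'" "s' \<le> s" "s \<le> s\<^sub>0" for s s'
    proof -
      define x u where "x = - ln s" and "u = ln (s / s')"
      have "s > 0" "s < c" using s c by (auto simp: s\<^sub>0_def)
      have "s' < c" using s \<open>s < c\<close> by simp
      have xu: "x + u = - ln s'" "u \<ge> 0"
        using s \<open>s > 0\<close> by (auto simp: x_def u_def ln_div)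
      have "s \<le> exp (- N)" using s by (simp add: s\<^sub>0_def)
      hence "ln s \<le> - N"
        using \<open>s > 0\<close> by (metis ln_exp ln_le_cancel_iff exp_gt_zero)
      hence "x \<ge> N" by (simp add: x_def)
      from N[OF this xu(2)] have "\<bar>f (- ln s') - f (- ln s)\<bar> \<le> \<delta> * (1 + u)"
        unfolding xu(1) by (simp add: x_def)
      moreover have "f (- ln s') = ln (L s')" "f (- ln s) = ln (L s)"
        using s \<open>s > 0\<close> \<open>s < c\<close> \<open>s' < c\<close> by (subst f_eq; simp)+
      ultimately show ?thesis by (simp add: u_def)
    qed
  qed
qed

text \<open>Slow variation in its definition allows only a fixed factor between the two arguments; the Potter
  bound extends it to factors that merely converge.\<close>

lemma slowly_varying_ratio:
  fixes L :: "real \<Rightarrow> real" and s s' :: "'b \<Rightarrow> real"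
  assumes L: "slowly_varying_at_0 L"
    and meas: "L \<in> borel_measurable (restrict_space borel {0<..<\<delta>\<^sub>0})" and "\<delta>\<^sub>0 > 0"
    and s: "filterlim s (at_right 0) F" and ratio: "((\<lambda>x. s' x / s x) \<longlongrightarrow> c) F" and "c > 0"
  shows "((\<lambda>x. L (s' x) / L (s x)) \<longlongrightarrow> 1) F"
proof -
  have s_pos: "\<forall>\<^sub>F x in F. s x > 0"
    using s by (auto simp: filterlim_at elim: eventually_mono)
  have s_0: "(s \<longlongrightarrow> 0) F"
    using s by (auto simp: filterlim_at)
  have "((\<lambda>x. (s' x / s x) * s x) \<longlongrightarrow> c * 0) F"
    by (intro tendsto_mult ratio s_0)
  moreover have "\<forall>\<^sub>F x in F. (s' x / s x) * s x = s' x"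
    using s_pos by eventually_elim auto
  ultimately have s'_0: "(s' \<longlongrightarrow> 0) F" by (simp add: tendsto_cong)
  have cs_0: "((\<lambda>x. c * s x) \<longlongrightarrow> 0) F" using tendsto_mult_right_zero[OF s_0] by simp
  have s'_pos: "\<forall>\<^sub>F x in F. s' x > 0"
    using order_tendstoD(1)[OF ratio, of 0] s_pos \<open>c > 0\<close>
    by (auto simp: zero_less_divide_iff elim: eventually_elim2)
  have "((\<lambda>x. s' x / s x / c) \<longlongrightarrow> c / c) F"
    by (intro tendsto_divide ratio tendsto_const) (use \<open>c > 0\<close> in auto)
  hence "((\<lambda>x. ln (s' x / s x / c)) \<longlongrightarrow> ln 1) F"
    using \<open>c > 0\<close> by (intro tendsto_ln) auto
  hence ln_ratio: "((\<lambda>x. ln (s' x / s x / c)) \<longlongrightarrow> 0) F" by simp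
  have "((\<lambda>x. ln (L (s' x)) - ln (L (c * s x))) \<longlongrightarrow> 0) F"
  proof (rule tendstoI)
    fix e :: real assume "e > 0"
    obtain s\<^sub>0 where s\<^sub>0: "s\<^sub>0 > 0"
      "\<And>s s'. 0 < s' \<Longrightarrow> s' \<le> s \<Longrightarrow> s \<le> s\<^sub>0 \<Longrightarrow> \<bar>ln (L s') - ln (L s)\<bar> \<le> e / 3 * (1 + ln (s / s'))"
      using slowly_varying_potter[OF L meas \<open>\<delta>\<^sub>0 > 0\<close>, of "e / 3"] \<open>e > 0\<close> by (metis divide_pos_pos zero_less_numeral)
    have "\<forall>\<^sub>F x in F. dist (ln (s' x / s x / c)) 0 < 1"
      using ln_ratio by (rule tendstoD) simp
    moreover have "\<forall>\<^sub>F x in F. s' x < s\<^sub>0" "\<forall>\<^sub>F x in F. c * s x < s\<^sub>0"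
      using order_tendstoD(2)[OF s'_0 s\<^sub>0(1)] order_tendstoD(2)[OF cs_0 s\<^sub>0(1)] .
    ultimately show "\<forall>\<^sub>F x in F. dist (ln (L (s' x)) - ln (L (c * s x))) 0 < e"
      using s_pos s'_pos
    proof eventually_elim
      case (elim x)
      hence pos: "c * s x > 0" using \<open>c > 0\<close> by simp
      have *: "ln (s' x / s x / c) = ln (s' x) - ln (c * s x)"
        using elim \<open>c > 0\<close> by (simp add: ln_div ln_mult)
      have "\<bar>ln (L (s' x)) - ln (L (c * s x))\<bar> \<le> e / 3 * (1 + \<bar>ln (s' x) - ln (c * s x)\<bar>)"
      proof (cases "s' x \<le> c * s x")
        case True
        have "ln (c * s x / s' x) \<le> \<bar>ln (s' x) - ln (c * s x)\<bar>"
          using elim pos by (subst ln_div) auto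
        hence "e / 3 * (1 + ln (c * s x / s' x)) \<le> e / 3 * (1 + \<bar>ln (s' x) - ln (c * s x)\<bar>)"
          using \<open>e > 0\<close> by (intro mult_left_mono) auto
        thus ?thesis using s\<^sub>0(2)[of "s' x" "c * s x"] True elim by auto
      next
        case False
        have "ln (s' x / (c * s x)) \<le> \<bar>ln (s' x) - ln (c * s x)\<bar>"
          using elim pos by (subst ln_div) auto
        hence "e / 3 * (1 + ln (s' x / (c * s x))) \<le> e / 3 * (1 + \<bar>ln (s' x) - ln (c * s x)\<bar>)"
          using \<open>e > 0\<close> by (intro mult_left_mono) auto
        thus ?thesis using s\<^sub>0(2)[of "c * s x" "s' x"] False pos elim by (auto simp: abs_minus_commute)
      qed
      also have "\<dots> \<le> e / 3 * 2"
        using elim * \<open>e > 0\<close> by (intro mult_left_mono) (auto simp: dist_real_def)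
      also have "\<dots> < e" using \<open>e > 0\<close> by simp
      finally show ?case by (simp add: dist_real_def)
    qed
  qed
  hence "((\<lambda>x. exp (ln (L (s' x)) - ln (L (c * s x)))) \<longlongrightarrow> exp 0) F"
    by (rule tendsto_exp)
  moreover have "\<forall>\<^sub>F x in F. exp (ln (L (s' x)) - ln (L (c * s x))) = L (s' x) / L (c * s x)"
  proof -
    note ev = slowly_varying_pos[OF L]
    have "\<forall>\<^sub>F x in F. L (s' x) > 0" 
      by (rule eventually_compose_filterlim[OF ev])
         (use s'_0 s'_pos in \<open>auto simp: filterlim_at elim: eventually_mono\<close>)
    moreover have "\<forall>\<^sub>F x in F. L (c * s x) > 0"
      by (rule eventually_compose_filterlim[OF ev])
         (use cs_0 s_pos \<open>c > 0\<close> in \<open>auto simp: filterlim_at elim: eventually_mono\<close>)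
    ultimately show ?thesis by eventually_elim (simp add: exp_diff)
  qed
  ultimately have 1: "((\<lambda>x. L (s' x) / L (c * s x)) \<longlongrightarrow> 1) F"
    by (simp add: tendsto_cong)
  have "((\<lambda>s. L (s * c) / L s) \<longlongrightarrow> 1) (at_right 0)"
    using L \<open>c > 0\<close> by (simp add: slowly_varying_at_0_def)
  hence "((\<lambda>x. L (s x * c) / L (s x)) \<longlongrightarrow> 1) F"
    using s by (rule filterlim_compose)
  from tendsto_mult[OF 1 this] have "((\<lambda>x. L (s' x) / L (c * s x) * (L (s x * c) / L (s x))) \<longlongrightarrow> 1) F"
    by simp
  moreover have "\<forall>\<^sub>F x in F. L (s' x) / L (c * s x) * (L (s x * c) / L (s x)) = L (s' x) / L (s x)"
  proof -
    note ev = slowly_varying_pos[OF L]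
    have "\<forall>\<^sub>F x in F. L (c * s x) > 0"
      by (rule eventually_compose_filterlim[OF ev])
         (use cs_0 s_pos \<open>c > 0\<close> in \<open>auto simp: filterlim_at elim: eventually_mono\<close>)
    thus ?thesis by eventually_elim (simp add: mult.commute)
  qed
  ultimately show ?thesis by (simp add: tendsto_cong)
qed

text \<open>Near \<open>0\<close> the function \<open>L\<close> lies between \<open>s powr \<delta>\<close> and \<open>s powr (- \<delta>)\<close>; this is what makes its
  contribution to the norming negligible against powers.\<close>

lemma slowly_varying_ln_bound:
  fixes L :: "real \<Rightarrow> real"
  assumes L: "slowly_varying_at_0 L"
    and meas: "L \<in> borel_measurable (restrict_space borel {0<..<\<delta>\<^sub>0})" and "\<delta>\<^sub>0 > 0"
    and "\<delta> > 0"
  shows "\<forall>\<^sub>F s in at_right 0. \<bar>ln (L s)\<bar> \<le> \<delta> * (- ln s)"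
proof -
  obtain s\<^sub>0 where s\<^sub>0: "s\<^sub>0 > 0"
      "\<And>s s'. 0 < s' \<Longrightarrow> s' \<le> s \<Longrightarrow> s \<le> s\<^sub>0 \<Longrightarrow> \<bar>ln (L s') - ln (L s)\<bar> \<le> \<delta> / 2 * (1 + ln (s / s'))"
    using slowly_varying_potter[OF L meas \<open>\<delta>\<^sub>0 > 0\<close>, of "\<delta> / 2"] \<open>\<delta> > 0\<close>
    by (metis divide_pos_pos zero_less_numeral)
  define K where "K = \<bar>ln (L s\<^sub>0)\<bar> + \<delta> / 2 * (1 + ln s\<^sub>0)"
  have "\<forall>\<^sub>F s in at_right (0::real). K / (\<delta> / 2) < - ln s"
    using ln_at_0 by (auto simp: filterlim_at_bot_dense filterlim_uminus_at_top[symmetric] elim!: allE[of _ "- (K / (\<delta> / 2))"] eventually_mono)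
  moreover have "\<forall>\<^sub>F s in at_right 0. s \<in> {0<..<s\<^sub>0}"
    using s\<^sub>0(1) by (rule eventually_at_right_real)
  ultimately show ?thesis
  proof eventually_elim
    case (elim s)
    have "\<bar>ln (L s)\<bar> \<le> \<bar>ln (L s\<^sub>0)\<bar> + \<delta> / 2 * (1 + ln (s\<^sub>0 / s))"
      using s\<^sub>0(2)[of s s\<^sub>0] elim by (simp del: times_divide_eq_left)
    also have "\<dots> = K + \<delta> / 2 * (- ln s)"
      using elim s\<^sub>0(1) by (simp add: K_def ln_div algebra_simps)
    also have "K \<le> \<delta> / 2 * (- ln s)"
      using elim(1) \<open>\<delta> > 0\<close> by (simp add: field_simps)
    finally show ?case by (simp add: algebra_simps)
  qed
qed

section \<open>The joint survival function\<close>

text \<open>The amount by which \<open>exponent_measure H (1 / x) (1 / y)\<close> exceeds its value \<open>x\<close> at \<open>y = 0\<close>.\<close>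

definition excess :: "real measure \<Rightarrow> real \<Rightarrow> real \<Rightarrow> real" where
  "excess H x y = (LINT w|H. max 0 ((1 - w) * y - w * x))"

text \<open>Equals \<open>exp v * P(v < X \<le> v + \<epsilon>, Y > y)\<close> for \<open>v, \<epsilon> > 0\<close>, see \<open>strip_survival\<close>.\<close>

definition strip :: "real measure \<Rightarrow> real \<Rightarrow> real \<Rightarrow> real \<Rightarrow> real" where
  "strip H \<epsilon> v y = exp (- excess H v y) - exp (- \<epsilon>) * exp (- excess H (v + \<epsilon>) y)"

lemma spectral_measureD:
  assumes "spectral_measure H"
  shows "finite_measure H" "sets H = sets borel" "space H = UNIV" "AE w in H. 0 \<le> w \<and> w \<le> 1"
    "measure H UNIV = 2" "(LINT w|H. w) = 1"
proof -
  have *: "finite_measure H" "sets H = sets borel" "emeasure H (- {0..1}) = 0" "measure H {0..1} = 2"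
    "(LINT w|H. w) = 1"
    using assms by (auto simp: spectral_measure_def)
  show "finite_measure H" "sets H = sets borel" "(LINT w|H. w) = 1" by fact+
  show sp: "space H = UNIV" using sets_eq_imp_space_eq[OF *(2)] by simp
  show AE: "AE w in H. 0 \<le> w \<and> w \<le> 1"
    by (rule AE_I[OF _ *(3)]) (auto simp: *(2) sp)
  have "measure H UNIV = measure H {0..1}"
    using AE by (intro measure_eq_AE) (auto simp: *(2))
  with * show "measure H UNIV = 2" by simp
qed

lemma spectral_integrable:
  fixes f :: "real \<Rightarrow> real"
  assumes "spectral_measure H" "f \<in> borel_measurable borel"
    and "\<And>w. 0 \<le> w \<Longrightarrow> w \<le> 1 \<Longrightarrow> \<bar>f w\<bar> \<le> B"
  shows "integrable H f"
proof -
  interpret finite_measure H using spectral_measureD[OF assms(1)] by simp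
  note [measurable_cong] = spectral_measureD(2)[OF assms(1)]
  show ?thesis
  proof (rule integrable_const_bound[where B = B])
    show "AE w in H. norm (f w) \<le> B"
      using spectral_measureD(4)[OF assms(1)] by eventually_elim (use assms(3) in auto)
    show "f \<in> borel_measurable H"
      using assms(2) by measurable
  qed
qed

lemma excess_kernel_bound:
  fixes w x y :: real
  assumes "0 \<le> w" "w \<le> 1"
  shows "\<bar>max 0 ((1 - w) * y - w * x)\<bar> \<le> \<bar>x\<bar> + \<bar>y\<bar>"
proof -
  have "\<bar>(1 - w) * y\<bar> \<le> 1 * \<bar>y\<bar>" "\<bar>w * x\<bar> \<le> 1 * \<bar>x\<bar>"
    unfolding abs_mult using assms by (intro mult_right_mono; simp)+
  thus ?thesis by linarith
qed

lemma integrable_excess: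
  assumes "spectral_measure H"
  shows "integrable H (\<lambda>w. max 0 ((1 - w) * y - w * x))"
  by (rule spectral_integrable[OF assms _ excess_kernel_bound]) simp_all

lemma exponent_measure_eq:
  assumes "spectral_measure H" "x > 0" "y > 0"
  shows "exponent_measure H (1 / x) (1 / y) = x + excess H x y"
proof -
  have "exponent_measure H (1 / x) (1 / y) = (LINT w|H. w * x + max 0 ((1 - w) * y - w * x))"
    unfolding exponent_measure_def by (intro Bochner_Integration.integral_cong) (auto simp: max_def)
  also have "\<dots> = (LINT w|H. w * x) + excess H x y"
    unfolding excess_def
    by (intro Bochner_Integration.integral_add integrable_excess assms
          spectral_integrable[OF assms(1), where B = "\<bar>x\<bar>"])
       (auto simp: abs_mult intro: mult_left_le_one_le)
  also have "(LINT w|H. w * x) = x"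
    using spectral_measureD(6)[OF assms(1)] by simp
  finally show ?thesis .
qed

text \<open>The upper bound integrates \<open>(1 - w) y\<close> against \<open>H\<close>, which gives \<open>y\<close> by the moment constraint. It
  forces the excess to vanish as \<open>y\<close> decreases to \<open>0\<close>.\<close>

lemma excess_bounds:
  assumes "spectral_measure H" "x \<ge> 0"
  shows "excess H x y \<ge> 0" and "excess H x y \<le> max 0 y"
proof -
  interpret finite_measure H using spectral_measureD[OF assms(1)] by simp
  show "excess H x y \<ge> 0"
    unfolding excess_def by (rule Bochner_Integration.integral_nonneg) simp
  have int: "integrable H (\<lambda>w. w)"
    using spectral_integrable[OF assms(1), of "\<lambda>w. w" 1] by simp
  have "excess H x y \<le> (LINT w|H. (1 - w) * max 0 y)"
    unfolding excess_def
  proof (rule integral_mono_AE)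
    show "integrable H (\<lambda>w. (1 - w) * max 0 y)" using int by simp
    show "AE w in H. max 0 ((1 - w) * y - w * x) \<le> (1 - w) * max 0 y"
      using spectral_measureD(4)[OF assms(1)]
    proof eventually_elim
      case (elim w)
      have "(1 - w) * y \<le> (1 - w) * max 0 y" "0 \<le> (1 - w) * max 0 y" "w * x \<ge> 0"
        using elim assms(2) by (auto intro: mult_left_mono)
      thus ?case by linarith
    qed
  qed (rule integrable_excess[OF assms(1)])
  also have "\<dots> = (measure H UNIV - (LINT w|H. w)) * max 0 y"
    using int spectral_measureD(3)[OF assms(1)] by simp
  also have "\<dots> = max 0 y"
    using spectral_measureD[OF assms(1)] by simp
  finally show "excess H x y \<le> max 0 y" .
qed

text \<open>The defining formula covers \<open>y > 0\<close>; the marginal law of \<open>X\<close> follows by letting \<open>y\<close> decrease to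
  \<open>0\<close>. For \<open>y \<le> 0\<close> the event reduces to \<open>X > x\<close> while the excess is \<open>0\<close>, so the same formula holds
  for all levels, which matters because the curves of interest may start below the axis.\<close>

lemma joint_survival:
  assumes "prob_space M" "spectral_measure H" "inverted_max_stable H M X Y" "x > 0"
  shows "\<P>(\<omega> in M. X \<omega> > x \<and> Y \<omega> > y) = exp (- x - excess H x y)"
    and "\<P>(\<omega> in M. X \<omega> > x) = exp (- x)"
proof -
  interpret prob_space M by fact
  have [measurable]: "X \<in> borel_measurable M" "Y \<in> borel_measurable M"
    and pos: "AE \<omega> in M. X \<omega> > 0 \<and> Y \<omega> > 0"
    and surv: "\<And>x y. x > 0 \<Longrightarrow> y > 0 \<Longrightarrow>
      \<P>(\<omega> in M. X \<omega> > x \<and> Y \<omega> > y) = exp (- exponent_measure H (1 / x) (1 / y))"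
    using assms(3) by (auto simp: inverted_max_stable_def)
  have surv': "\<P>(\<omega> in M. X \<omega> > x \<and> Y \<omega> > y) = exp (- x - excess H x y)" if "y > 0" for y
    using surv[OF \<open>x > 0\<close> that] exponent_measure_eq[OF assms(2) \<open>x > 0\<close> that] by simp
  have "(\<lambda>n. \<P>(\<omega> in M. X \<omega> > x \<and> Y \<omega> > inverse (real (Suc n)))) \<longlonglongrightarrow>
      prob (\<Union>n. {\<omega>\<in>space M. X \<omega> > x \<and> Y \<omega> > inverse (real (Suc n))})"
  proof (rule finite_Lim_measure_incseq)
    show "incseq (\<lambda>n. {\<omega>\<in>space M. X \<omega> > x \<and> Y \<omega> > inverse (real (Suc n))})"
    proof (rule incseq_SucI, safe)
      fix n \<omega> assume "inverse (real (Suc n)) < Y \<omega>"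
      moreover have "inverse (real (Suc (Suc n))) \<le> inverse (real (Suc n))" by simp
      ultimately show "inverse (real (Suc (Suc n))) < Y \<omega>" by linarith
    qed
  qed auto
  also have "prob (\<Union>n. {\<omega>\<in>space M. X \<omega> > x \<and> Y \<omega> > inverse (real (Suc n))}) = \<P>(\<omega> in M. X \<omega> > x)"
  proof (rule measure_eq_AE)
    show "AE \<omega> in M. \<omega> \<in> (\<Union>n. {\<omega>\<in>space M. X \<omega> > x \<and> Y \<omega> > inverse (real (Suc n))}) \<longleftrightarrow>
        \<omega> \<in> {\<omega>\<in>space M. X \<omega> > x}"
      using pos by eventually_elim (auto dest: reals_Archimedean simp del: of_nat_Suc)
  qed auto
  finally have "(\<lambda>n. exp (- x - excess H x (inverse (real (Suc n))))) \<longlonglongrightarrow> \<P>(\<omega> in M. X \<omega> > x)"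
    by (subst (asm) surv') auto
  moreover have "(\<lambda>n. exp (- x - excess H x (inverse (real (Suc n))))) \<longlonglongrightarrow> exp (- x - 0)"
  proof (intro tendsto_intros)
    show "(\<lambda>n. excess H x (inverse (real (Suc n)))) \<longlonglongrightarrow> 0"
    proof (rule tendsto_sandwich[OF _ _ tendsto_const LIMSEQ_inverse_real_of_nat])
      show "\<forall>\<^sub>F n in sequentially. 0 \<le> excess H x (inverse (real (Suc n)))"
        using excess_bounds(1)[OF assms(2), of x] \<open>x > 0\<close> by simp
      have "excess H x (inverse (real (Suc n))) \<le> inverse (real (Suc n))" for n
        using excess_bounds(2)[OF assms(2), of x "inverse (real (Suc n))"] \<open>x > 0\<close> by (simp add: max_absorb2)
      thus "\<forall>\<^sub>F n in sequentially. excess H x (inverse (real (Suc n))) \<le> inverse (real (Suc n))"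
        by simp
    qed
  qed
  ultimately show marg: "\<P>(\<omega> in M. X \<omega> > x) = exp (- x)"
    by (simp add: LIMSEQ_unique)
  show "\<P>(\<omega> in M. X \<omega> > x \<and> Y \<omega> > y) = exp (- x - excess H x y)"
  proof (cases "y > 0")
    case False
    have "\<P>(\<omega> in M. X \<omega> > x \<and> Y \<omega> > y) = \<P>(\<omega> in M. X \<omega> > x)"
    proof (rule measure_eq_AE)
      show "AE \<omega> in M. \<omega> \<in> {\<omega>\<in>space M. X \<omega> > x \<and> Y \<omega> > y} \<longleftrightarrow> \<omega> \<in> {\<omega>\<in>space M. X \<omega> > x}"
        using pos by eventually_elim (use False in auto)
    qed auto
    moreover have "excess H x y = 0"
      using excess_bounds[OF assms(2), of x y] \<open>x > 0\<close> False by (simp add: max_def split: if_splits)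
    ultimately show ?thesis using marg by simp
  qed (rule surv')
qed

lemma strip_survival:
  assumes "prob_space M" "spectral_measure H" "inverted_max_stable H M X Y" "v > 0" "\<epsilon> > 0"
  shows "\<P>(\<omega> in M. v < X \<omega> \<and> X \<omega> \<le> v + \<epsilon> \<and> Y \<omega> > y) = exp (- v) * strip H \<epsilon> v y"
proof -
  interpret prob_space M by fact
  have [measurable]: "X \<in> borel_measurable M" "Y \<in> borel_measurable M"
    using assms(3) by (auto simp: inverted_max_stable_def)
  have "\<P>(\<omega> in M. X \<omega> > v \<and> Y \<omega> > y) - \<P>(\<omega> in M. X \<omega> > v + \<epsilon> \<and> Y \<omega> > y) =
      prob ({\<omega>\<in>space M. X \<omega> > v \<and> Y \<omega> > y} - {\<omega>\<in>space M. X \<omega> > v + \<epsilon> \<and> Y \<omega> > y})"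
    using \<open>\<epsilon> > 0\<close> by (subst finite_measure_Diff) auto
  also have "{\<omega>\<in>space M. X \<omega> > v \<and> Y \<omega> > y} - {\<omega>\<in>space M. X \<omega> > v + \<epsilon> \<and> Y \<omega> > y} =
      {\<omega>\<in>space M. v < X \<omega> \<and> X \<omega> \<le> v + \<epsilon> \<and> Y \<omega> > y}"
    by auto
  finally show ?thesis
    using assms by (simp add: joint_survival[OF assms(1-3)] strip_def algebra_simps exp_add[symmetric] exp_diff[symmetric])
qed

section \<open>Regions above a curve\<close>

text \<open>The increments say that \<open>R v - B * exp (- v)\<close> does not decrease along the progression \<open>v + n \<epsilon>\<close>, and
  it tends to \<open>0\<close>, so it is nonpositive.\<close>

lemma exp_tail_bound_from_increments:
  fixes R :: "real \<Rightarrow> real"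
  assumes "\<epsilon> > 0" and incr: "\<And>v. v \<ge> V \<Longrightarrow> R v - R (v + \<epsilon>) \<le> B * (exp (- v) - exp (- (v + \<epsilon>)))"
    and lim: "(R \<longlongrightarrow> 0) at_top" and "v \<ge> V"
  shows "R v \<le> B * exp (- v)"
proof -
  define T where "T = (\<lambda>v. R v - B * exp (- v))"
  have step: "T v \<le> T (v + real n * \<epsilon>)" for n
  proof (induction n)
    case (Suc n)
    have "v + real n * \<epsilon> \<ge> V" using \<open>v \<ge> V\<close> \<open>\<epsilon> > 0\<close> by (simp add: add_increasing2)
    from incr[OF this] have "T (v + real n * \<epsilon>) \<le> T (v + real (Suc n) * \<epsilon>)"
      by (simp add: T_def algebra_simps)
    with Suc show ?case by simp
  qed simp
  have "(T \<longlongrightarrow> 0 - B * 0) at_top"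
    unfolding T_def
    by (intro tendsto_intros lim filterlim_compose[OF exp_at_bot] filterlim_uminus_at_bot_at_top)
  moreover have "filterlim (\<lambda>n. v + real n * \<epsilon>) at_top sequentially"
    by (intro filterlim_tendsto_add_at_top[OF tendsto_const] filterlim_at_top_mult_tendsto_pos[OF tendsto_const \<open>\<epsilon> > 0\<close>]
        filterlim_real_sequentially)
  ultimately have "(\<lambda>n. T (v + real n * \<epsilon>)) \<longlonglongrightarrow> 0 - B * 0"
    by (rule filterlim_compose)
  hence "T v \<le> 0"
    using step by (intro LIMSEQ_le_const[where X = "\<lambda>n. T (v + real n * \<epsilon>)"]) auto
  thus ?thesis by (simp add: T_def)
qed

text \<open>The region above the curve \<open>g\<close> can be approximated, in strips of a suitable width \<open>\<epsilon>\<close>, by regions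
  above horizontal levels whose probabilities are asymptotically within \<open>\<eta>\<close> of the share \<open>q\<close> of the
  whole strip. The width may depend on \<open>\<eta>\<close>, since a sloping curve needs thin strips.\<close>

definition strip_approximable :: "real measure \<Rightarrow> (real \<Rightarrow> real) \<Rightarrow> real \<Rightarrow> bool" where
  "strip_approximable H g q \<longleftrightarrow>
     (\<forall>\<eta>>0. \<exists>\<epsilon>>0. \<exists>lo hi A B.
        (\<forall>\<^sub>F v in at_top. \<forall>x\<in>{v<..v + \<epsilon>}. lo v < g x \<and> g x \<le> hi v) \<and>
        ((\<lambda>v. strip H \<epsilon> v (lo v)) \<longlongrightarrow> A) at_top \<and> A < (q + \<eta>) * (1 - exp (- \<epsilon>)) \<and>
        ((\<lambda>v. strip H \<epsilon> v (hi v)) \<longlongrightarrow> B) at_top \<and> (q - \<eta>) * (1 - exp (- \<epsilon>)) < B)"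

text \<open>Being close to the share \<open>q\<close> in every strip far out, the region has share close to \<open>q\<close> in the whole
  half plane beyond \<open>v\<close>, by telescoping over the strips.\<close>

lemma survival_above_curve:
  assumes "prob_space M" "spectral_measure H" "inverted_max_stable H M X Y"
    and [measurable]: "g \<in> borel_measurable borel"
    and approx: "strip_approximable H g q"
  shows "((\<lambda>v. exp v * \<P>(\<omega> in M. X \<omega> > v \<and> Y \<omega> \<ge> g (X \<omega>))) \<longlongrightarrow> q) at_top"
proof (rule tendstoI)
  interpret prob_space M by fact
  have [measurable]: "X \<in> borel_measurable M" "Y \<in> borel_measurable M"
    using assms(3) by (auto simp: inverted_max_stable_def)
  define R where "R = (\<lambda>v. \<P>(\<omega> in M. X \<omega> > v \<and> Y \<omega> \<ge> g (X \<omega>)))"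
  have R_lim: "(R \<longlongrightarrow> 0) at_top"
  proof (rule tendsto_sandwich[OF _ _ tendsto_const])
    show "((\<lambda>v::real. exp (- v)) \<longlongrightarrow> 0) at_top"
      by (intro filterlim_compose[OF exp_at_bot] filterlim_uminus_at_bot_at_top)
    show "\<forall>\<^sub>F v in at_top. R v \<le> exp (- v)"
      using eventually_gt_at_top[of 0]
    proof eventually_elim
      case (elim v)
      have "R v \<le> \<P>(\<omega> in M. X \<omega> > v)"
        unfolding R_def by (intro finite_measure_mono) auto
      thus ?case using joint_survival(2)[OF assms(1-3) elim] by simp
    qed
  qed (simp add: R_def)
  have R_incr: "R v - R (v + \<epsilon>) = \<P>(\<omega> in M. v < X \<omega> \<and> X \<omega> \<le> v + \<epsilon> \<and> Y \<omega> \<ge> g (X \<omega>))"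
    if "\<epsilon> > 0" for v \<epsilon>
  proof -
    have "R v - R (v + \<epsilon>) =
        prob ({\<omega>\<in>space M. X \<omega> > v \<and> Y \<omega> \<ge> g (X \<omega>)} - {\<omega>\<in>space M. X \<omega> > v + \<epsilon> \<and> Y \<omega> \<ge> g (X \<omega>)})"
      unfolding R_def using that by (subst finite_measure_Diff) auto
    also have "{\<omega>\<in>space M. X \<omega> > v \<and> Y \<omega> \<ge> g (X \<omega>)} - {\<omega>\<in>space M. X \<omega> > v + \<epsilon> \<and> Y \<omega> \<ge> g (X \<omega>)} =
        {\<omega>\<in>space M. v < X \<omega> \<and> X \<omega> \<le> v + \<epsilon> \<and> Y \<omega> \<ge> g (X \<omega>)}"
      by auto
    finally show ?thesis .
  qed
  fix e :: real assume "e > 0"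
  hence "e / 2 > 0" by simp
  then obtain \<epsilon> lo hi A B where "\<epsilon> > 0"
    and curve: "\<forall>\<^sub>F v in at_top. \<forall>x\<in>{v<..v + \<epsilon>}. lo v < g x \<and> g x \<le> hi v"
    and A: "((\<lambda>v. strip H \<epsilon> v (lo v)) \<longlongrightarrow> A) at_top" "A < (q + e / 2) * (1 - exp (- \<epsilon>))"
    and B: "((\<lambda>v. strip H \<epsilon> v (hi v)) \<longlongrightarrow> B) at_top" "(q - e / 2) * (1 - exp (- \<epsilon>)) < B"
    using approx unfolding strip_approximable_def by meson
  have "\<forall>\<^sub>F v in at_top.
      R v - R (v + \<epsilon>) \<le> (q + e / 2) * (exp (- v) - exp (- (v + \<epsilon>))) \<and>
      (q - e / 2) * (exp (- v) - exp (- (v + \<epsilon>))) \<le> R v - R (v + \<epsilon>)"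
    using curve order_tendstoD(2)[OF A] order_tendstoD(1)[OF B] eventually_gt_at_top[of 0]
  proof eventually_elim
    case (elim v)
    have curve_v: "lo v < g x" "g x \<le> hi v" if "v < x" "x \<le> v + \<epsilon>" for x
      using elim(1) that by auto
    have "R v - R (v + \<epsilon>) \<le> \<P>(\<omega> in M. v < X \<omega> \<and> X \<omega> \<le> v + \<epsilon> \<and> Y \<omega> > lo v)"
      unfolding R_incr[OF \<open>\<epsilon> > 0\<close>]
    proof (rule finite_measure_mono)
      show "{\<omega>\<in>space M. v < X \<omega> \<and> X \<omega> \<le> v + \<epsilon> \<and> Y \<omega> \<ge> g (X \<omega>)} \<subseteq> {\<omega>\<in>space M. v < X \<omega> \<and> X \<omega> \<le> v + \<epsilon> \<and> Y \<omega> > lo v}" using curve_v(1) less_le_trans by blast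
    qed measurable
    also have "\<dots> = exp (- v) * strip H \<epsilon> v (lo v)"
      by (rule strip_survival) (use assms elim \<open>\<epsilon> > 0\<close> in auto)
    also have "\<dots> \<le> exp (- v) * ((q + e / 2) * (1 - exp (- \<epsilon>)))"
      using elim by (intro mult_left_mono) auto
    finally have 1: "R v - R (v + \<epsilon>) \<le> exp (- v) * ((q + e / 2) * (1 - exp (- \<epsilon>)))" .
    have "exp (- v) * ((q - e / 2) * (1 - exp (- \<epsilon>))) \<le> exp (- v) * strip H \<epsilon> v (hi v)"
      using elim by (intro mult_left_mono) auto
    also have "\<dots> = \<P>(\<omega> in M. v < X \<omega> \<and> X \<omega> \<le> v + \<epsilon> \<and> Y \<omega> > hi v)"
      by (rule strip_survival[symmetric]) (use assms elim \<open>\<epsilon> > 0\<close> in auto)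
    also have "\<dots> \<le> R v - R (v + \<epsilon>)"
      unfolding R_incr[OF \<open>\<epsilon> > 0\<close>]
    proof (rule finite_measure_mono)
      show "{\<omega>\<in>space M. v < X \<omega> \<and> X \<omega> \<le> v + \<epsilon> \<and> Y \<omega> > hi v} \<subseteq> {\<omega>\<in>space M. v < X \<omega> \<and> X \<omega> \<le> v + \<epsilon> \<and> Y \<omega> \<ge> g (X \<omega>)}" using curve_v(2) le_less_trans less_imp_le by blast
    qed measurable
    finally have 2: "exp (- v) * ((q - e / 2) * (1 - exp (- \<epsilon>))) \<le> R v - R (v + \<epsilon>)" .
    have "exp (- v) - exp (- (v + \<epsilon>)) = exp (- v) * (1 - exp (- \<epsilon>))"
      by (simp add: right_diff_distrib exp_add[symmetric])
    with 1 2 show ?case by (simp only: mult.left_commute[of "exp (- v)"])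
  qed
  then obtain V where V: "\<And>v. v \<ge> V \<Longrightarrow> R v - R (v + \<epsilon>) \<le> (q + e / 2) * (exp (- v) - exp (- (v + \<epsilon>)))"
      "\<And>v. v \<ge> V \<Longrightarrow> (q - e / 2) * (exp (- v) - exp (- (v + \<epsilon>))) \<le> R v - R (v + \<epsilon>)"
    unfolding eventually_at_top_linorder by blast
  have upper: "R v \<le> (q + e / 2) * exp (- v)" if "v \<ge> V" for v
    using \<open>\<epsilon> > 0\<close> V(1) R_lim that by (rule exp_tail_bound_from_increments)
  \<comment> \<open>The lower estimate is the upper one for \<open>- R\<close>.\<close>
  have lower: "- R v \<le> - (q - e / 2) * exp (- v)" if "v \<ge> V" for v
  proof (rule exp_tail_bound_from_increments[OF \<open>\<epsilon> > 0\<close> _ _ that])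
    show "- R v - - R (v + \<epsilon>) \<le> - (q - e / 2) * (exp (- v) - exp (- (v + \<epsilon>)))" if "v \<ge> V" for v
      using V(2)[OF that] by (simp only: mult_minus_left)
    show "((\<lambda>v. - R v) \<longlongrightarrow> 0) at_top" using tendsto_minus[OF R_lim] by simp
  qed
  show "\<forall>\<^sub>F v in at_top. dist (exp v * \<P>(\<omega> in M. X \<omega> > v \<and> Y \<omega> \<ge> g (X \<omega>))) q < e"
    using eventually_ge_at_top[of V]
  proof eventually_elim
    case (elim v)
    have cancel: "exp v * (c * exp (- v)) = c" for c
      by (simp add: exp_minus)
    have "exp v * R v \<le> q + e / 2"
      using mult_left_mono[OF upper[OF elim] exp_ge_zero[of v]] unfolding cancel .
    moreover have "q - e / 2 \<le> exp v * R v"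
      using mult_left_mono[OF lower[OF elim] exp_ge_zero[of v]] unfolding cancel by simp
    ultimately have "dist (exp v * R v) q < e"
      using \<open>e > 0\<close> unfolding dist_real_def by linarith
    thus ?case by (simp add: R_def)
  qed
qed

section \<open>From regions to the conditional limit\<close>

text \<open>Conditioning on \<open>X > u\<close> sees the norming functions only beyond \<open>u\<close>.\<close>

lemma conditional_limit_cong:
  assumes "\<forall>\<^sub>F x in at_top. a x = a' x" "\<forall>\<^sub>F x in at_top. b x = b' x"
  shows "conditional_limit M X Y a b G \<longleftrightarrow> conditional_limit M X Y a' b' G"
proof -
  obtain u\<^sub>0 where u\<^sub>0: "\<And>x. x \<ge> u\<^sub>0 \<Longrightarrow> a x = a' x \<and> b x = b' x"
    using eventually_conj[OF assms] unfolding eventually_at_top_linorder by blast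
  have "((\<lambda>u. \<P>(\<omega> in M. X \<omega> - u > x \<and> (Y \<omega> - a (X \<omega>)) / b (X \<omega>) < z \<bar> X \<omega> > u)) \<longlongrightarrow> l) at_top \<longleftrightarrow>
      ((\<lambda>u. \<P>(\<omega> in M. X \<omega> - u > x \<and> (Y \<omega> - a' (X \<omega>)) / b' (X \<omega>) < z \<bar> X \<omega> > u)) \<longlongrightarrow> l) at_top"
    if "x > 0" for x z l
  proof (rule tendsto_cong)
    show "\<forall>\<^sub>F u in at_top. \<P>(\<omega> in M. X \<omega> - u > x \<and> (Y \<omega> - a (X \<omega>)) / b (X \<omega>) < z \<bar> X \<omega> > u) =
        \<P>(\<omega> in M. X \<omega> - u > x \<and> (Y \<omega> - a' (X \<omega>)) / b' (X \<omega>) < z \<bar> X \<omega> > u)"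
      using eventually_ge_at_top[of u\<^sub>0]
    proof eventually_elim
      case (elim u)
      have "X \<omega> - u > x \<and> (Y \<omega> - a (X \<omega>)) / b (X \<omega>) < z \<longleftrightarrow>
          X \<omega> - u > x \<and> (Y \<omega> - a' (X \<omega>)) / b' (X \<omega>) < z" for \<omega>
        using u\<^sub>0[of "X \<omega>"] elim \<open>x > 0\<close> by auto
      thus ?case by simp
    qed
  qed
  thus ?thesis by (simp add: conditional_limit_def)
qed

text \<open>Monotonicity squeezes the values at \<open>c\<close> between those at neighbouring points, where convergence is
  known.\<close>

lemma tendsto_at_continuity_point:
  fixes F :: "'b \<Rightarrow> real \<Rightarrow> real" and G :: "real \<Rightarrow> real"
  assumes mono: "\<And>z z'. z \<le> z' \<Longrightarrow> \<forall>\<^sub>F u in U. F u z \<le> F u z'"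
    and lim: "\<And>z. z \<noteq> c \<Longrightarrow> ((\<lambda>u. F u z) \<longlongrightarrow> G z) U" and "isCont G c"
  shows "((\<lambda>u. F u c) \<longlongrightarrow> G c) U"
proof (rule order_tendstoI)
  have right: "(G \<longlongrightarrow> G c) (at_right c)" and left: "(G \<longlongrightarrow> G c) (at_left c)"
    using \<open>isCont G c\<close> by (auto simp: isCont_def intro: filterlim_at_split[THEN iffD1, THEN conjunct1] filterlim_at_split[THEN iffD1, THEN conjunct2])
  fix y
  {
    assume "y < G c"
    from order_tendstoD(1)[OF left this] obtain z where "z < c" "y < G z"
      by (metis (mono_tags, lifting) eventually_at_left_field dense)
    have "\<forall>\<^sub>F u in U. y < F u z"
      using lim[of z] \<open>z < c\<close> \<open>y < G z\<close> by (intro order_tendstoD(1)) auto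
    with mono[of z c] \<open>z < c\<close> show "\<forall>\<^sub>F u in U. y < F u c"
      by (auto elim: eventually_elim2)
  next
    assume "y > G c"
    from order_tendstoD(2)[OF right this] obtain z where "z > c" "y > G z"
      by (metis (mono_tags, lifting) eventually_at_right_field dense)
    have "\<forall>\<^sub>F u in U. F u z < y"
      using lim[of z] \<open>z > c\<close> \<open>y > G z\<close> by (intro order_tendstoD(2)) auto
    with mono[of c z] \<open>z > c\<close> show "\<forall>\<^sub>F u in U. F u c < y"
      by (auto elim: eventually_elim2)
  }
qed

text \<open>The event \<open>(Y - a X) / b X < z\<close> is the complement of the region above the curve \<open>a x + z * b x\<close>. The
  point \<open>z = 0\<close>, where the limit may jump, is excluded from the hypothesis and recovered by
  monotonicity if it is a continuity point.\<close>

lemma conditional_limit_from_strips: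
  assumes "prob_space M" "spectral_measure H" "inverted_max_stable H M X Y"
    and [measurable]: "a \<in> borel_measurable borel" "b \<in> borel_measurable borel"
    and b_pos: "\<forall>\<^sub>F x in at_top. b x > 0"
    and approx: "\<And>z. z \<noteq> 0 \<Longrightarrow> strip_approximable H (\<lambda>x. a x + z * b x) (1 - G z)"
  shows "conditional_limit M X Y a b G"
proof -
  interpret prob_space M by fact
  have [measurable]: "X \<in> borel_measurable M" "Y \<in> borel_measurable M"
    using assms(3) by (auto simp: inverted_max_stable_def)
  obtain u\<^sub>0 where u\<^sub>0: "\<And>x. x \<ge> u\<^sub>0 \<Longrightarrow> b x > 0"
    using b_pos unfolding eventually_at_top_linorder by blast
  define F where "F = (\<lambda>x u z. \<P>(\<omega> in M. X \<omega> - u > x \<and> (Y \<omega> - a (X \<omega>)) / b (X \<omega>) < z \<bar> X \<omega> > u))"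
  have lim: "((\<lambda>u. F x u z) \<longlongrightarrow> exp (- x) * G z) at_top" if "x > 0" "z \<noteq> 0" for x z
  proof -
    define S where "S = (\<lambda>v. \<P>(\<omega> in M. X \<omega> > v \<and> Y \<omega> \<ge> a (X \<omega>) + z * b (X \<omega>)))"
    have "((\<lambda>v. exp v * S v) \<longlongrightarrow> 1 - G z) at_top"
      unfolding S_def by (rule survival_above_curve[OF assms(1-3) _ approx]) (use that in simp_all)
    moreover have "filterlim (\<lambda>u. x + u) at_top at_top"
      by (rule filterlim_tendsto_add_at_top[OF tendsto_const filterlim_ident])
    ultimately have "((\<lambda>u. exp (x + u) * S (x + u)) \<longlongrightarrow> 1 - G z) at_top"
      by (rule filterlim_compose)
    hence "((\<lambda>u. exp (- x) * (1 - exp (x + u) * S (x + u))) \<longlongrightarrow> exp (- x) * (1 - (1 - G z))) at_top"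
      by (intro tendsto_intros)
    moreover have "\<forall>\<^sub>F u in at_top. exp (- x) * (1 - exp (x + u) * S (x + u)) = F x u z"
      using eventually_ge_at_top[of u\<^sub>0] eventually_gt_at_top[of 0]
    proof eventually_elim
      case (elim u)
      have "F x u z = \<P>(\<omega> in M. X \<omega> > x + u \<and> \<not> Y \<omega> \<ge> a (X \<omega>) + z * b (X \<omega>)) / \<P>(\<omega> in M. X \<omega> > u)"
      proof -
        have "(X \<omega> - u > x \<and> (Y \<omega> - a (X \<omega>)) / b (X \<omega>) < z) \<and> X \<omega> > u \<longleftrightarrow>
            X \<omega> > x + u \<and> \<not> Y \<omega> \<ge> a (X \<omega>) + z * b (X \<omega>)" for \<omega>
          using u\<^sub>0[of "X \<omega>"] elim \<open>x > 0\<close> by (auto simp: field_simps not_le)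
        thus ?thesis by (simp add: F_def cond_prob_def)
      qed
      also have "\<P>(\<omega> in M. X \<omega> > x + u \<and> \<not> Y \<omega> \<ge> a (X \<omega>) + z * b (X \<omega>)) =
          \<P>(\<omega> in M. X \<omega> > x + u) - S (x + u)"
      proof -
        have "\<P>(\<omega> in M. X \<omega> > x + u) - S (x + u) =
            prob ({\<omega>\<in>space M. X \<omega> > x + u} - {\<omega>\<in>space M. X \<omega> > x + u \<and> Y \<omega> \<ge> a (X \<omega>) + z * b (X \<omega>)})"
          unfolding S_def by (subst finite_measure_Diff) auto
        also have "{\<omega>\<in>space M. X \<omega> > x + u} - {\<omega>\<in>space M. X \<omega> > x + u \<and> Y \<omega> \<ge> a (X \<omega>) + z * b (X \<omega>)} =
            {\<omega>\<in>space M. X \<omega> > x + u \<and> \<not> Y \<omega> \<ge> a (X \<omega>) + z * b (X \<omega>)}"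
          by auto
        finally show ?thesis by simp
      qed
      also have "(\<P>(\<omega> in M. X \<omega> > x + u) - S (x + u)) / \<P>(\<omega> in M. X \<omega> > u) =
          exp (- x) * (1 - exp (x + u) * S (x + u))"
      proof -
        have "exp u * exp (- (x + u)) = exp (- x)" "exp (- x) * exp (x + u) = exp u"
          by (simp_all add: exp_add[symmetric])
        hence "exp u * (exp (- (x + u)) - S (x + u)) = exp (- x) * (1 - exp (x + u) * S (x + u))"
          by (metis (no_types, opaque_lifting) mult.assoc mult.right_neutral right_diff_distrib)
        thus ?thesis
          using elim \<open>x > 0\<close>
          by (simp add: joint_survival(2)[OF assms(1-3)] exp_minus[of u] divide_inverse mult.commute)
      qed
      finally show ?case by simp
    qed
    ultimately show ?thesis by (simp add: tendsto_cong)
  qed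
  have "((\<lambda>u. F x u z) \<longlongrightarrow> exp (- x) * G z) at_top" if "x > 0" "isCont G z" for x z
  proof (cases "z = 0")
    case True
    have "((\<lambda>u. F x u 0) \<longlongrightarrow> exp (- x) * G 0) at_top"
    proof (rule tendsto_at_continuity_point[where G = "\<lambda>z. exp (- x) * G z"])
      show "\<forall>\<^sub>F u in at_top. F x u z \<le> F x u z'" if "z \<le> z'" for z z'
        unfolding F_def cond_prob_def using that
        by (intro always_eventually allI divide_right_mono finite_measure_mono) auto
      show "isCont (\<lambda>z. exp (- x) * G z) 0"
        using that(2) True by (intro continuous_intros) auto
    qed (use lim \<open>x > 0\<close> in auto)
    with True show ?thesis by simp
  qed (use lim \<open>x > 0\<close> in auto)
  thus ?thesis unfolding conditional_limit_def F_def by blast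
qed

section \<open>An atom at the lower end point\<close>

text \<open>The complement of the support is a union of open null sets, and by the Lindeloef property countably many of them
  suffice.\<close>

lemma AE_ge_lower_end_point:
  assumes "spectral_measure H"
  shows "AE w in H. lower_end_point H \<le> w"
proof -
  note sets_H = spectral_measureD(2)[OF assms]
  define F where "F = {U :: real set. open U \<and> emeasure H U = 0}"
  obtain F' where F': "F' \<subseteq> F" "countable F'" "\<Union>F' = \<Union>F"
    using Lindelof[of F] by (auto simp: F_def)
  have "(\<Union>U\<in>F'. U) \<in> null_sets H"
    using F' by (intro null_sets_UN') (auto simp: F_def null_sets_def sets_H)
  hence null: "\<Union>F \<in> null_sets H" using F'(3) by simp
  have out: "w \<in> \<Union>F" if "w \<notin> measure_support H" for w
    using that by (auto simp: measure_support_def F_def not_gr_zero)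
  have "AE w in H. w \<notin> {..<0}"
    using spectral_measureD(4)[OF assms] by eventually_elim auto
  hence "emeasure H {..<0} = 0"
    by (subst (asm) AE_iff_null_sets[symmetric]) (auto simp: sets_H)
  hence "0 \<le> w" if "w \<in> measure_support H" for w
    using that unfolding measure_support_def
    by (auto simp: not_less[symmetric] dest!: spec[of _ "{..<0}"])
  hence bdd: "bdd_below (measure_support H)" by (rule bdd_belowI[of _ 0])
  show ?thesis
  proof (rule AE_I'[OF null], safe)
    fix w assume "\<not> lower_end_point H \<le> w"
    hence "w \<notin> measure_support H"
      using cInf_lower[OF _ bdd, of w] by (auto simp: lower_end_point_def)
    thus "w \<in> \<Union>F" by (rule out)
  qed
qed

text \<open>Along lines of slope \<open>w\<^sub>0 / (1 - w\<^sub>0)\<close> the kernel at \<open>w = w\<^sub>0\<close> does not depend on \<open>x\<close>, and for \<open>w > w\<^sub>0\<close> it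
  decreases linearly in \<open>x\<close>.\<close>

lemma excess_kernel_from_edge:
  fixes w w\<^sub>0 x \<zeta> :: real
  assumes "w\<^sub>0 \<noteq> 1"
  shows "(1 - w) * (w\<^sub>0 / (1 - w\<^sub>0) * x + \<zeta>) - w * x = (1 - w) * \<zeta> - (w - w\<^sub>0) / (1 - w\<^sub>0) * x"
  using assms by (simp add: field_simps)

text \<open>For \<open>w > w\<^sub>0\<close> the kernel is eventually \<open>0\<close>, so only the atom at \<open>w\<^sub>0\<close> survives.\<close>

lemma excess_limit_atom:
  assumes H: "spectral_measure H" and w\<^sub>0: "w\<^sub>0 = lower_end_point H" "w\<^sub>0 < 1"
  shows "((\<lambda>x. excess H x (w\<^sub>0 / (1 - w\<^sub>0) * x + \<zeta>)) \<longlongrightarrow>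
           (1 - w\<^sub>0) * measure H {w\<^sub>0} * max 0 \<zeta>) at_top"
proof -
  note [measurable_cong] = spectral_measureD(2)[OF H]
  interpret finite_measure H by (rule spectral_measureD[OF H])
  have AE: "AE w in H. w\<^sub>0 \<le> w \<and> w \<le> 1"
    using spectral_measureD(4)[OF H] AE_ge_lower_end_point[OF H] unfolding w\<^sub>0(1) by eventually_elim auto
  let ?k = "\<lambda>x w. max 0 ((1 - w) * (w\<^sub>0 / (1 - w\<^sub>0) * x + \<zeta>) - w * x)"
  have "((\<lambda>x. LINT w|H. ?k x w) \<longlongrightarrow> (LINT w|H. indicator {w\<^sub>0} w *\<^sub>R ((1 - w\<^sub>0) * max 0 \<zeta>))) at_top"
  proof (rule integral_dominated_convergence_at_top[where w = "\<lambda>_. \<bar>\<zeta>\<bar>"])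
    show "AE w in H. ((\<lambda>x. ?k x w) \<longlongrightarrow> indicator {w\<^sub>0} w *\<^sub>R ((1 - w\<^sub>0) * max 0 \<zeta>)) at_top"
      using AE
    proof eventually_elim
      case (elim w)
      show ?case
      proof (cases "w = w\<^sub>0")
        case True
        have "?k x w = (1 - w\<^sub>0) * max 0 \<zeta>" for x
          using w\<^sub>0(2) True by (subst excess_kernel_from_edge) (auto simp: max_def mult_le_0_iff zero_le_mult_iff)
        thus ?thesis using True by simp
      next
        case False
        define r where "r = (w - w\<^sub>0) / (1 - w\<^sub>0)"
        have "r > 0" using False elim w\<^sub>0(2) by (simp add: r_def)
        have "\<forall>\<^sub>F x in at_top. ?k x w = 0"
          using eventually_ge_at_top[of "(1 - w) * \<zeta> / r"]
        proof eventually_elim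
          case (elim x)
          have "(1 - w) * \<zeta> \<le> r * x" using elim \<open>r > 0\<close> by (simp add: field_simps)
          thus ?case using w\<^sub>0(2) by (subst excess_kernel_from_edge) (auto simp: r_def)
        qed
        thus ?thesis using False by (auto intro: tendsto_eventually)
      qed
    qed
    show "\<forall>\<^sub>F x in at_top. AE w in H. norm (?k x w) \<le> \<bar>\<zeta>\<bar>"
      using eventually_ge_at_top[of 0]
    proof eventually_elim
      case (elim x)
      show ?case
        using AE spectral_measureD(4)[OF H]
      proof eventually_elim
        case (elim w)
        have "(w - w\<^sub>0) / (1 - w\<^sub>0) * x \<ge> 0" using elim \<open>0 \<le> x\<close> w\<^sub>0(2) by auto
        moreover have "\<bar>(1 - w) * \<zeta>\<bar> \<le> 1 * \<bar>\<zeta>\<bar>"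
          unfolding abs_mult using elim by (intro mult_right_mono) auto
        ultimately show ?case using w\<^sub>0(2) by (subst excess_kernel_from_edge) auto
      qed
    qed
  qed auto
  also have "(LINT w|H. indicator {w\<^sub>0} w *\<^sub>R ((1 - w\<^sub>0) * max 0 \<zeta>)) = (1 - w\<^sub>0) * measure H {w\<^sub>0} * max 0 \<zeta>"
    by (subst integral_scaleR_left) (auto simp: emeasure_eq_measure spectral_measureD(2,3)[OF H])
  finally show ?thesis unfolding excess_def .
qed

lemma strip_limit_atom:
  assumes H: "spectral_measure H" and w\<^sub>0: "w\<^sub>0 = lower_end_point H" "w\<^sub>0 < 1"
  defines "c \<equiv> w\<^sub>0 / (1 - w\<^sub>0)" and "\<kappa> \<equiv> (1 - w\<^sub>0) * measure H {w\<^sub>0}"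
  shows "((\<lambda>v. strip H \<epsilon> v (c * v + \<zeta>)) \<longlongrightarrow>
           exp (- (\<kappa> * max 0 \<zeta>)) - exp (- \<epsilon>) * exp (- (\<kappa> * max 0 (\<zeta> - c * \<epsilon>)))) at_top"
proof -
  have "filterlim (\<lambda>v. \<epsilon> + v) at_top at_top"
    by (rule filterlim_tendsto_add_at_top[OF tendsto_const filterlim_ident])
  from filterlim_compose[OF excess_limit_atom[OF H w\<^sub>0, of "\<zeta> - c * \<epsilon>"] this]
  have "((\<lambda>v. excess H (v + \<epsilon>) (c * v + \<zeta>)) \<longlongrightarrow> \<kappa> * max 0 (\<zeta> - c * \<epsilon>)) at_top"
    unfolding c_def[symmetric] \<kappa>_def[symmetric] by (simp add: algebra_simps)
  thus ?thesis
    using excess_limit_atom[OF H w\<^sub>0, of \<zeta>] unfolding c_def[symmetric] \<kappa>_def[symmetric] strip_def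
    by (intro tendsto_intros)
qed

text \<open>With \<open>\<kappa> = (1 - w\<^sub>0) p\<close>, the share of a strip above the level \<open>c v + \<zeta>\<close> with \<open>\<zeta> > c \<epsilon>\<close> tends to
  \<open>exp (- \<kappa> \<zeta>) (1 - exp (- (1 - \<kappa> c) \<epsilon>)) / (1 - exp (- \<epsilon>))\<close>: moving right by \<open>\<epsilon>\<close> loses the factor
  \<open>exp (- \<epsilon>)\<close> but gains \<open>exp (\<kappa> c \<epsilon>)\<close>, because the level falls relative to the line. As
  \<open>\<epsilon> \<longrightarrow> 0\<close> the quotient tends to \<open>1 - \<kappa> c = 1 - w\<^sub>0 p\<close>.\<close>

lemma strip_approximable_atom:
  assumes H: "spectral_measure H" and w\<^sub>0: "w\<^sub>0 = lower_end_point H" "0 \<le> w\<^sub>0" "w\<^sub>0 < 1 / 2"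
    and "z \<noteq> 0"
  defines "p \<equiv> measure H {w\<^sub>0}"
  shows "strip_approximable H (\<lambda>x. w\<^sub>0 / (1 - w\<^sub>0) * x + z * 1)
           (if z < 0 then 1 else (1 - w\<^sub>0 * p) * exp (- ((1 - w\<^sub>0) * p * z)))"
proof -
  define c where "c = w\<^sub>0 / (1 - w\<^sub>0)"
  define \<kappa> where "\<kappa> = (1 - w\<^sub>0) * p"
  have c: "0 \<le> c" "c \<le> 1" using w\<^sub>0 by (auto simp: c_def field_simps)
  have \<kappa>c: "w\<^sub>0 * p = \<kappa> * c" using w\<^sub>0 by (simp add: c_def \<kappa>_def)
  define q where "q = (if z < 0 then 1 else (1 - \<kappa> * c) * exp (- (\<kappa> * z)))"
  define Q where "Q = (\<lambda>\<epsilon> \<zeta>. exp (- (\<kappa> * max 0 \<zeta>)) - exp (- \<epsilon>) * exp (- (\<kappa> * max 0 (\<zeta> - c * \<epsilon>))))"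
  have "w\<^sub>0 < 1" using w\<^sub>0 by simp
  hence lim: "((\<lambda>v. strip H \<epsilon> v (c * v + \<zeta>)) \<longlongrightarrow> Q \<epsilon> \<zeta>) at_top" for \<epsilon> \<zeta>
    using strip_limit_atom[OF H w\<^sub>0(1), of \<epsilon> \<zeta>] unfolding Q_def c_def \<kappa>_def p_def by simp
  have curve: "c * v + (z - \<epsilon>) < c * x + z" "c * x + z \<le> c * v + (z + \<epsilon>)"
    if "\<epsilon> > 0" "v < x" "x \<le> v + \<epsilon>" for \<epsilon> v x
  proof -
    have "c * v \<le> c * x" "c * x \<le> c * (v + \<epsilon>)" "c * \<epsilon> \<le> 1 * \<epsilon>"
      using that c by (auto intro!: mult_left_mono mult_right_mono)
    thus "c * v + (z - \<epsilon>) < c * x + z" "c * x + z \<le> c * v + (z + \<epsilon>)"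
      using \<open>\<epsilon> > 0\<close> unfolding distrib_left by linarith+
  qed
  have "\<exists>\<epsilon>>0. Q \<epsilon> (z - \<epsilon>) < (q + \<eta>) * (1 - exp (- \<epsilon>)) \<and> (q - \<eta>) * (1 - exp (- \<epsilon>)) < Q \<epsilon> (z + \<epsilon>)"
    if "\<eta> > 0" for \<eta>
  proof (cases "z < 0")
    case True
    \<comment> \<open>Both levels then stay below the line, where the excess vanishes.\<close>
    define \<epsilon> where "\<epsilon> = - z / 2"
    have "\<epsilon> > 0" using True by (simp add: \<epsilon>_def)
    hence "z - \<epsilon> - c * \<epsilon> \<le> 0" "z + \<epsilon> - c * \<epsilon> \<le> 0" "z - \<epsilon> \<le> 0" "z + \<epsilon> \<le> 0"
      using True c mult_nonneg_nonneg[of c \<epsilon>] by (auto simp: \<epsilon>_def)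
    hence "Q \<epsilon> (z - \<epsilon>) = 1 - exp (- \<epsilon>)" "Q \<epsilon> (z + \<epsilon>) = 1 - exp (- \<epsilon>)"
      by (simp_all add: Q_def max_absorb1)
    moreover have "\<eta> * (1 - exp (- \<epsilon>)) > 0" using \<open>\<epsilon> > 0\<close> \<open>\<eta> > 0\<close> by simp
    ultimately show ?thesis
      using \<open>\<epsilon> > 0\<close> True by (intro exI[of _ \<epsilon>]) (auto simp: q_def distrib_right left_diff_distrib)
  next
    case False
    with \<open>z \<noteq> 0\<close> have "z > 0" by simp
    have slope: "((\<lambda>\<epsilon>::real. (1 - exp (- (a * \<epsilon>))) / (1 - exp (- \<epsilon>))) \<longlongrightarrow> a) (at_right 0)" for a :: real
    proof (cases "a = 0")
      case False
      then consider "a > 0" | "a < 0" by linarith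
      thus ?thesis by cases real_asymp+
    qed simp
    have Q_eq: "\<forall>\<^sub>F \<epsilon> in at_right 0. Q \<epsilon> (z + \<sigma> * \<epsilon>) / (1 - exp (- \<epsilon>)) =
        exp (- (\<kappa> * (z + \<sigma> * \<epsilon>))) * ((1 - exp (- ((1 - \<kappa> * c) * \<epsilon>))) / (1 - exp (- \<epsilon>)))"
      if "\<bar>\<sigma>\<bar> \<le> 1" for \<sigma>
    proof -
      have "\<forall>\<^sub>F \<epsilon> in at_right 0. \<epsilon> \<in> {0<..<z / 2}"
        using \<open>z > 0\<close> by (intro eventually_at_right_real) simp
      thus ?thesis
      proof eventually_elim
        case (elim \<epsilon>)
        have "\<bar>\<sigma> * \<epsilon>\<bar> \<le> 1 * \<epsilon>" "c * \<epsilon> \<le> 1 * \<epsilon>" "0 \<le> c * \<epsilon>"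
          using elim that c unfolding abs_mult by (auto intro!: mult_mono)
        hence "z + \<sigma> * \<epsilon> - c * \<epsilon> \<ge> 0" "z + \<sigma> * \<epsilon> \<ge> 0"
          using elim unfolding greaterThanLessThan_iff by linarith+
        hence "Q \<epsilon> (z + \<sigma> * \<epsilon>) =
            exp (- (\<kappa> * (z + \<sigma> * \<epsilon>))) - exp (- \<epsilon>) * exp (- (\<kappa> * (z + \<sigma> * \<epsilon> - c * \<epsilon>)))"
          by (simp add: Q_def max_absorb2)
        also have "\<dots> = exp (- (\<kappa> * (z + \<sigma> * \<epsilon>))) * (1 - exp (- ((1 - \<kappa> * c) * \<epsilon>)))"
          by (simp add: algebra_simps exp_add[symmetric])
        finally show ?case by simp
      qed
    qed
    have Q_lim: "((\<lambda>\<epsilon>. Q \<epsilon> (z + \<sigma> * \<epsilon>) / (1 - exp (- \<epsilon>))) \<longlongrightarrow> q) (at_right 0)" if "\<bar>\<sigma>\<bar> \<le> 1" for \<sigma>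
    proof -
      have "((\<lambda>\<epsilon>. exp (- (\<kappa> * (z + \<sigma> * \<epsilon>))) * ((1 - exp (- ((1 - \<kappa> * c) * \<epsilon>))) / (1 - exp (- \<epsilon>)))) \<longlongrightarrow>
          exp (- (\<kappa> * (z + \<sigma> * 0))) * (1 - \<kappa> * c)) (at_right 0)"
        by (intro tendsto_mult[OF _ slope] tendsto_intros)
      also have "exp (- (\<kappa> * (z + \<sigma> * 0))) * (1 - \<kappa> * c) = q"
        using False by (simp add: q_def)
      finally show ?thesis by (rule Lim_transform_eventually) (use Q_eq[OF that] in \<open>auto elim: eventually_mono\<close>)
    qed
    have "\<forall>\<^sub>F \<epsilon> in at_right 0. Q \<epsilon> (z + (-1) * \<epsilon>) / (1 - exp (- \<epsilon>)) < q + \<eta>"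
      using \<open>\<eta> > 0\<close> by (intro order_tendstoD(2)[OF Q_lim]) auto
    moreover have "\<forall>\<^sub>F \<epsilon> in at_right 0. q - \<eta> < Q \<epsilon> (z + 1 * \<epsilon>) / (1 - exp (- \<epsilon>))"
      using \<open>\<eta> > 0\<close> by (intro order_tendstoD(1)[OF Q_lim]) auto
    moreover have "\<forall>\<^sub>F \<epsilon>::real in at_right 0. \<epsilon> > 0" by (rule eventually_at_right_less)
    ultimately have "\<forall>\<^sub>F \<epsilon> in at_right 0. \<epsilon> > 0 \<and> Q \<epsilon> (z - \<epsilon>) < (q + \<eta>) * (1 - exp (- \<epsilon>)) \<and>
        (q - \<eta>) * (1 - exp (- \<epsilon>)) < Q \<epsilon> (z + \<epsilon>)"
      by eventually_elim (auto simp: divide_less_eq less_divide_eq)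
    thus ?thesis
      using eventually_happens'[OF trivial_limit_at_right_real] by blast
  qed
  hence "strip_approximable H (\<lambda>x. c * x + z * 1) q"
    unfolding strip_approximable_def
  proof (intro allI impI, goal_cases)
    case (1 \<eta>)
    then obtain \<epsilon> where \<epsilon>: "\<epsilon> > 0" "Q \<epsilon> (z - \<epsilon>) < (q + \<eta>) * (1 - exp (- \<epsilon>))"
      "(q - \<eta>) * (1 - exp (- \<epsilon>)) < Q \<epsilon> (z + \<epsilon>)" by blast
    show ?case
    proof (intro exI conjI)
      show "\<epsilon> > 0" by fact
      show "\<forall>\<^sub>F v in at_top. \<forall>x\<in>{v<..v + \<epsilon>}. c * v + (z - \<epsilon>) < c * x + z * 1 \<and> c * x + z * 1 \<le> c * v + (z + \<epsilon>)"
        using curve[OF \<epsilon>(1)] by (intro always_eventually) simp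
    qed (fact lim \<epsilon>)+
  qed
  thus ?thesis unfolding q_def c_def[symmetric] \<kappa>c \<kappa>_def[symmetric] by simp
qed

section \<open>A Karamata integral\<close>

lemma lborel_integral_of_has_integral:
  fixes f :: "real \<Rightarrow> real"
  assumes "f \<in> borel_measurable borel" "(f has_integral I) {0..1}" "\<And>x. x \<in> {0..1} \<Longrightarrow> 0 \<le> f x"
  shows "integrable lborel (\<lambda>x. indicator {0..1} x * f x)"
    and "(LINT x|lborel. indicator {0..1} x * f x) = I"
proof -
  have "f absolutely_integrable_on {0..1}"
    using assms by (intro nonnegative_absolutely_integrable_1) auto
  hence "integrable lebesgue (\<lambda>x. indicator {0..1} x * f x)"
    by (simp add: set_integrable_def)
  thus int: "integrable lborel (\<lambda>x. indicator {0..1} x * f x)"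
    using assms(1) by (subst (asm) integrable_completion) auto
  hence "(LINT x:{0..1}|lborel. f x) = integral {0..1} f"
    by (intro set_borel_integral_eq_integral) (simp add: set_integrable_def)
  thus "(LINT x|lborel. indicator {0..1} x * f x) = I"
    using assms(2) by (simp add: set_lebesgue_integral_def integral_unique)
qed

lemma integrable_powr_unit_interval:
  fixes a :: real
  assumes "a > -1"
  shows "integrable lborel (\<lambda>x. indicator {0..1} x * x powr a)"
  by (rule lborel_integral_of_has_integral(1)[OF _ has_integral_powr_from_0[of a 1]]) (use assms in auto)

lemma integral_one_minus_powr:
  fixes t :: real
  assumes "t > -1"
  shows "(LINT x|lborel. indicator {0..1} x * ((1 - x) * x powr t)) = 1 / ((t + 1) * (t + 2))"
proof (rule lborel_integral_of_has_integral(2))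
  have "((\<lambda>x. x powr t - x powr (t + 1)) has_integral
      (1 powr (t + 1) / (t + 1) - 1 powr (t + 1 + 1) / (t + 1 + 1))) {0..1}"
    using assms by (intro has_integral_diff has_integral_powr_from_0) auto
  moreover have "1 powr (t + 1) / (t + 1) - 1 powr (t + 1 + 1) / (t + 1 + 1) = 1 / ((t + 1) * (t + 2))"
    using assms by (simp add: divide_simps)
  moreover have "x powr t - x powr (t + 1) = (1 - x) * x powr t" if "x \<in> {0..1}" for x
    using that by (auto simp: powr_add algebra_simps)
  ultimately show "((\<lambda>x. (1 - x) * x powr t) has_integral 1 / ((t + 1) * (t + 2))) {0..1}"
    by (subst has_integral_cong[symmetric, where f = "\<lambda>x. x powr t - x powr (t + 1)"]) auto
qed auto

text \<open>After division the integrand converges pointwise to \<open>(1 - l) * l powr t\<close>. The Potter bound dominates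
  it by a multiple of \<open>l powr (t - \<delta>)\<close>, integrable as long as \<open>\<delta> < t + 1\<close>.\<close>

lemma karamata_weighted:
  fixes L k :: "real \<Rightarrow> real"
  assumes L: "slowly_varying_at_0 L"
    and meas: "L \<in> borel_measurable (restrict_space borel {0<..<\<delta>\<^sub>0})" "\<delta>\<^sub>0 > 0"
    and [measurable]: "k \<in> borel_measurable borel"
    and k: "((\<lambda>s. k s / (L s * s powr t)) \<longlongrightarrow> 1) (at_right 0)" and "t > -1"
  shows "((\<lambda>S. (LINT l|lborel. indicator {0..1} l * ((1 - l) * k (S * l))) / (L S * S powr t))
            \<longlongrightarrow> 1 / ((t + 1) * (t + 2))) (at_right 0)"
proof -
  define \<delta> where "\<delta> = (t + 1) / 2"
  have \<delta>: "\<delta> > 0" "t - \<delta> > -1" using \<open>t > -1\<close> by (auto simp: \<delta>_def field_simps)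
  obtain s\<^sub>0 where s\<^sub>0: "s\<^sub>0 > 0" "\<And>s. 0 < s \<Longrightarrow> s \<le> s\<^sub>0 \<Longrightarrow> L s > 0"
    "\<And>s s'. 0 < s' \<Longrightarrow> s' \<le> s \<Longrightarrow> s \<le> s\<^sub>0 \<Longrightarrow> \<bar>ln (L s') - ln (L s)\<bar> \<le> \<delta> * (1 + ln (s / s'))"
    using slowly_varying_potter[OF L meas \<delta>(1)] by metis
  have "\<forall>\<^sub>F s in at_right 0. \<bar>k s / (L s * s powr t)\<bar> < 2"
    using tendsto_rabs[OF k] by (intro order_tendstoD(2)) auto
  then obtain s\<^sub>1 where s\<^sub>1: "s\<^sub>1 > 0" "\<And>s. 0 < s \<Longrightarrow> s < s\<^sub>1 \<Longrightarrow> \<bar>k s / (L s * s powr t)\<bar> < 2"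
    unfolding eventually_at_right_field by auto
  define J where "J = (\<lambda>S l. indicator {0..1} l * ((1 - l) * (k (S * l) / (L S * S powr t))))"
  have split: "k (S * l) / (L S * S powr t) =
      (k (S * l) / (L (S * l) * (S * l) powr t)) * (L (S * l) / L S) * l powr t"
    if "0 < S" "S \<le> s\<^sub>0" "0 < l" "l \<le> 1" for S l
  proof -
    have "S * l \<le> s\<^sub>0" using that mult_left_le[of l S] by linarith
    hence "L (S * l) > 0" "L S > 0" using that by (auto intro!: s\<^sub>0(2))
    thus ?thesis using that by (simp add: powr_mult)
  qed
  have bound: "\<bar>J S l\<bar> \<le> indicator {0..1} l * (2 * exp \<delta> * l powr (t - \<delta>))"
    if S: "0 < S" "S \<le> s\<^sub>0" "S < s\<^sub>1" and "l \<noteq> 0" for S l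
  proof (cases "0 < l \<and> l \<le> 1")
    case True
    hence Sl: "0 < S * l" "S * l \<le> S" using S mult_left_le[of l S] by auto
    have pos: "L (S * l) > 0" "L S > 0" using S Sl by (auto intro!: s\<^sub>0(2))
    have "ln (L (S * l)) - ln (L S) \<le> \<delta> * (1 + ln (S / (S * l)))"
      using s\<^sub>0(3)[OF Sl S(2)] by linarith
    also have "\<dots> = \<delta> + - \<delta> * ln l" using True S by (simp add: ln_div algebra_simps)
    finally have "exp (ln (L (S * l)) - ln (L S)) \<le> exp (\<delta> + - \<delta> * ln l)" by simp
    hence L_le: "L (S * l) / L S \<le> exp \<delta> * l powr (- \<delta>)"
      using pos True by (simp only: exp_diff exp_add exp_ln powr_def) (simp add: mult.commute)
    have "\<bar>k (S * l) / (L S * S powr t)\<bar> =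
        \<bar>k (S * l) / (L (S * l) * (S * l) powr t)\<bar> * (L (S * l) / L S) * l powr t"
      using pos True by (subst split) (use S True in \<open>auto simp: abs_mult\<close>)
    also have "\<dots> \<le> 2 * (exp \<delta> * l powr (- \<delta>)) * l powr t"
      using s\<^sub>1(2)[of "S * l"] Sl S L_le pos by (intro mult_right_mono mult_mono) auto
    also have "\<dots> = 2 * exp \<delta> * l powr (t - \<delta>)"
      by (simp add: mult.assoc flip: powr_add)
    finally have "\<bar>1 - l\<bar> * \<bar>k (S * l) / (L S * S powr t)\<bar> \<le> 1 * (2 * exp \<delta> * l powr (t - \<delta>))"
      using True by (intro mult_mono) auto
    thus ?thesis using True by (simp add: J_def abs_mult)
  next
    case False
    thus ?thesis using \<open>l \<noteq> 0\<close> by (auto simp: J_def indicator_def)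
  qed
  have small: "\<forall>\<^sub>F x in at_top. 0 < inverse x \<and> inverse x < min s\<^sub>0 s\<^sub>1"
    using eventually_gt_at_top[of 0] eventually_gt_at_top[of "inverse (min s\<^sub>0 s\<^sub>1)"]
  proof eventually_elim
    case (elim x)
    have "inverse x < inverse (inverse (min s\<^sub>0 s\<^sub>1))"
      using elim(2) s\<^sub>0(1) s\<^sub>1(1) by (intro less_imp_inverse_less) auto
    thus ?case using elim(1) by simp
  qed
  have "((\<lambda>x. LINT l|lborel. J (inverse x) l) \<longlongrightarrow>
      (LINT l|lborel. indicator {0..1} l * ((1 - l) * l powr t))) at_top"
  proof (rule integral_dominated_convergence_at_top
           [where w = "\<lambda>l. indicator {0..1} l * (2 * exp \<delta> * l powr (t - \<delta>))"])
    show "integrable lborel (\<lambda>l. indicator {0..1} l * (2 * exp \<delta> * l powr (t - \<delta>)))"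
      using integrable_mult_right[OF integrable_powr_unit_interval[OF \<delta>(2)], of "2 * exp \<delta>"]
      by (simp add: mult_ac)
    show "\<forall>\<^sub>F x in at_top. AE l in lborel.
        norm (J (inverse x) l) \<le> indicator {0..1} l * (2 * exp \<delta> * l powr (t - \<delta>))"
      using small
    proof eventually_elim
      case (elim x)
      show ?case
        using AE_lborel_singleton[of 0] by eventually_elim (use bound[of "inverse x"] elim in auto)
    qed
    show "AE l in lborel. ((\<lambda>x. J (inverse x) l) \<longlongrightarrow> indicator {0..1} l * ((1 - l) * l powr t)) at_top"
      using AE_lborel_singleton[of 0]
    proof eventually_elim
      case (elim l)
      show ?case
      proof (cases "0 < l \<and> l \<le> 1")
        case True
        have "((\<lambda>S. S * l) \<longlongrightarrow> 0 * l) (at_right 0)"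
          by (intro tendsto_intros)
        moreover have "\<forall>\<^sub>F S in at_right 0. S * l > 0"
          using eventually_at_right_less[of 0] by eventually_elim (use True in auto)
        ultimately have Sl: "filterlim (\<lambda>S. S * l) (at_right 0) (at_right 0)"
          by (auto simp: filterlim_at elim: eventually_mono)
        have "((\<lambda>S. (k (S * l) / (L (S * l) * (S * l) powr t)) * (L (S * l) / L S) * l powr t) \<longlongrightarrow>
            1 * 1 * l powr t) (at_right 0)"
          using L True
          by (intro tendsto_mult filterlim_compose[OF k Sl] tendsto_const) (auto simp: slowly_varying_at_0_def)
        moreover have "\<forall>\<^sub>F S in at_right 0.
            (k (S * l) / (L (S * l) * (S * l) powr t)) * (L (S * l) / L S) * l powr t = k (S * l) / (L S * S powr t)"
          using eventually_at_right_real[OF s\<^sub>0(1)] by eventually_elim (use split True in auto)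
        ultimately have "((\<lambda>S. k (S * l) / (L S * S powr t)) \<longlongrightarrow> l powr t) (at_right 0)"
          by (simp add: tendsto_cong)
        hence "((\<lambda>S. J S l) \<longlongrightarrow> indicator {0..1} l * ((1 - l) * l powr t)) (at_right 0)"
          unfolding J_def by (intro tendsto_intros)
        thus ?thesis by (simp add: filterlim_at_right_to_top)
      next
        case False
        thus ?thesis using elim by (auto simp: J_def indicator_def)
      qed
    qed
  qed (auto simp: J_def)
  hence "((\<lambda>S. LINT l|lborel. J S l) \<longlongrightarrow> 1 / ((t + 1) * (t + 2))) (at_right 0)"
    using integral_one_minus_powr[OF \<open>t > -1\<close>] by (simp add: filterlim_at_right_to_top)
  moreover have "(LINT l|lborel. J S l) =
      (LINT l|lborel. indicator {0..1} l * ((1 - l) * k (S * l))) / (L S * S powr t)" for S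
    by (simp add: J_def flip: integral_divide_zero)
  ultimately show ?thesis by simp
qed

section \<open>The excess without an atom at the lower end point\<close>

text \<open>In terms of the distance \<open>s\<close> from \<open>w\<^sub>0\<close> the kernel is the triangle \<open>D * max 0 (S - s)\<close>; scaling by
  \<open>S\<close> normalises the window to \<open>{0..1}\<close>. The condition on \<open>w\<^sub>1\<close> keeps the window clear of the other
  point where \<open>H\<close> may have an atom.\<close>

lemma excess_eq_density_integral:
  assumes H: "spectral_measure H" and w\<^sub>0: "w\<^sub>0 = lower_end_point H" "w\<^sub>0 < 1"
    and no_atom: "measure H {w\<^sub>0} = 0" and dens: "has_density_off {w\<^sub>0, w\<^sub>1} H h"
    and "x > 0" "\<zeta> > 0"
  defines "D \<equiv> x / (1 - w\<^sub>0) + \<zeta>"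
  defines "S \<equiv> (1 - w\<^sub>0) * \<zeta> / D"
  assumes S_less: "w\<^sub>0 + S < w\<^sub>1"
  shows "excess H x (w\<^sub>0 / (1 - w\<^sub>0) * x + \<zeta>) =
           D * S\<^sup>2 * (LINT l|lborel. indicator {0..1} l * ((1 - l) * h (w\<^sub>0 + S * l)))"
proof -
  note [measurable_cong] = spectral_measureD(2)[OF H]
  interpret finite_measure H by (rule spectral_measureD[OF H])
  have [measurable]: "h \<in> borel_measurable borel" and h_nonneg: "\<And>w. h w \<ge> 0"
    and dens_eq: "density H (indicator (- {w\<^sub>0, w\<^sub>1})) = density lborel (\<lambda>w. ennreal (h w))"
    using dens by (auto simp: has_density_off_def)
  have "D > 0" using \<open>x > 0\<close> \<open>\<zeta> > 0\<close> w\<^sub>0(2) by (simp add: D_def add_pos_pos)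
  hence "S > 0" using \<open>\<zeta> > 0\<close> w\<^sub>0(2) by (simp add: S_def)
  define k where "k = (\<lambda>w. max 0 (D * (S - (w - w\<^sub>0))))"
  have [measurable]: "k \<in> borel_measurable borel" unfolding k_def by measurable
  have k_eq: "max 0 ((1 - w) * (w\<^sub>0 / (1 - w\<^sub>0) * x + \<zeta>) - w * x) = k w" for w
  proof -
    have "D * S = (1 - w\<^sub>0) * \<zeta>" using \<open>D > 0\<close> by (simp add: S_def)
    hence "D * (S - (w - w\<^sub>0)) = (1 - w\<^sub>0) * \<zeta> - (w - w\<^sub>0) * D" by (simp add: algebra_simps)
    also have "\<dots> = (1 - w) * \<zeta> - (w - w\<^sub>0) / (1 - w\<^sub>0) * x" by (simp add: D_def algebra_simps)
    finally show ?thesis using w\<^sub>0(2) by (subst excess_kernel_from_edge) (auto simp: k_def)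
  qed
  have h_zero: "AE w in lborel. w < w\<^sub>0 \<longrightarrow> h w = 0"
  proof -
    have "AE w in density H (indicator (- {w\<^sub>0, w\<^sub>1})). w\<^sub>0 \<le> w"
      using AE_ge_lower_end_point[OF H] unfolding w\<^sub>0(1)
      by (subst AE_density) (auto elim: eventually_mono)
    hence "AE w in lborel. 0 < ennreal (h w) \<longrightarrow> w\<^sub>0 \<le> w"
      unfolding dens_eq by (subst (asm) AE_density) auto
    thus ?thesis by eventually_elim (use h_nonneg in \<open>force simp: less_le\<close>)
  qed
  have "excess H x (w\<^sub>0 / (1 - w\<^sub>0) * x + \<zeta>) = (LINT w|H. k w)"
    unfolding excess_def k_eq ..
  also have "\<dots> = (LINT w|H. indicator (- {w\<^sub>0, w\<^sub>1}) w *\<^sub>R k w)"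
  proof (rule integral_cong_AE)
    have "AE w in H. w \<notin> {w\<^sub>0}"
      using no_atom by (intro AE_not_in) (auto simp: null_sets_def emeasure_eq_measure spectral_measureD(2)[OF H])
    moreover have "k w\<^sub>1 = 0"
      using S_less \<open>D > 0\<close> by (auto simp: k_def max_def zero_le_mult_iff)
    ultimately show "AE w in H. k w = indicator (- {w\<^sub>0, w\<^sub>1}) w *\<^sub>R k w"
      by (auto elim!: eventually_mono simp: indicator_def)
  qed auto
  also have "\<dots> = (LINT w|density H (indicator (- {w\<^sub>0, w\<^sub>1})). k w)"
    using integral_density[of k H "indicator (- {w\<^sub>0, w\<^sub>1})"] by (simp add: ennreal_indicator)
  also have "\<dots> = (LINT w|lborel. h w * k w)"
    unfolding dens_eq using h_nonneg by (subst integral_density) auto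
  also have "\<dots> = (LINT w|lborel. indicator {w\<^sub>0..w\<^sub>0 + S} w * (h w * (D * (S - (w - w\<^sub>0)))))"
  proof (rule integral_cong_AE)
    show "AE w in lborel. h w * k w = indicator {w\<^sub>0..w\<^sub>0 + S} w * (h w * (D * (S - (w - w\<^sub>0))))"
      using h_zero
      by eventually_elim (use \<open>D > 0\<close> in \<open>auto simp: k_def indicator_def max_def zero_le_mult_iff mult_le_0_iff\<close>)
  qed auto
  also have "\<dots> = S * (LINT l|lborel. indicator {w\<^sub>0..w\<^sub>0 + S} (w\<^sub>0 + S * l) *
      (h (w\<^sub>0 + S * l) * (D * (S - (w\<^sub>0 + S * l - w\<^sub>0)))))"
    using \<open>S > 0\<close> by (subst lborel_integral_real_affine[where c = S and t = w\<^sub>0]) auto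
  also have "\<dots> = S * (LINT l|lborel. D * S * (indicator {0..1} l * ((1 - l) * h (w\<^sub>0 + S * l))))"
  proof -
    have "indicator {w\<^sub>0..w\<^sub>0 + S} (w\<^sub>0 + S * l) = (indicator {0..1} l :: real)" for l
      using \<open>S > 0\<close> by (auto simp: indicator_def zero_le_mult_iff)
    moreover have "D * (S - (w\<^sub>0 + S * l - w\<^sub>0)) = D * S * (1 - l)" for l
      by (simp add: algebra_simps)
    ultimately have "indicator {w\<^sub>0..w\<^sub>0 + S} (w\<^sub>0 + S * l) * (h (w\<^sub>0 + S * l) * (D * (S - (w\<^sub>0 + S * l - w\<^sub>0)))) =
        D * S * (indicator {0..1} l * ((1 - l) * h (w\<^sub>0 + S * l)))" for l
      by simp
    thus ?thesis by presburger
  qed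
  finally show ?thesis by (simp add: power2_eq_square)
qed

text \<open>Moving \<open>x\<close> by \<open>\<epsilon>\<close> changes the kernel by at most \<open>w \<epsilon>\<close>, and only for \<open>w\<close> in a window that shrinks
  to \<open>{w\<^sub>0}\<close>, a null set.\<close>

lemma excess_step_vanishes:
  fixes \<zeta> :: "real \<Rightarrow> real"
  assumes H: "spectral_measure H" and w\<^sub>0: "w\<^sub>0 = lower_end_point H" "w\<^sub>0 < 1"
    and no_atom: "measure H {w\<^sub>0} = 0" and \<zeta>: "((\<lambda>v. \<zeta> v / v) \<longlongrightarrow> 0) at_top" and "\<epsilon> \<ge> 0"
  shows "((\<lambda>v. excess H v (w\<^sub>0 / (1 - w\<^sub>0) * v + \<zeta> v) - excess H (v + \<epsilon>) (w\<^sub>0 / (1 - w\<^sub>0) * v + \<zeta> v))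
           \<longlongrightarrow> 0) at_top"
proof -
  note [measurable_cong] = spectral_measureD(2)[OF H]
  interpret finite_measure H by (rule spectral_measureD[OF H])
  define y where "y = (\<lambda>v. w\<^sub>0 / (1 - w\<^sub>0) * v + \<zeta> v)"
  let ?d = "\<lambda>v w. max 0 ((1 - w) * y v - w * v) - max 0 ((1 - w) * y v - w * (v + \<epsilon>))"
  have null: "AE w in H. w \<notin> {w\<^sub>0}"
    using no_atom by (intro AE_not_in) (auto simp: null_sets_def emeasure_eq_measure spectral_measureD(2)[OF H])
  have "((\<lambda>v. LINT w|H. ?d v w) \<longlongrightarrow> (LINT w|H. 0)) at_top"
  proof (rule integral_dominated_convergence_at_top[where w = "\<lambda>_. \<epsilon>"])
    show "AE w in H. ((\<lambda>v. ?d v w) \<longlongrightarrow> 0) at_top"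
      using null AE_ge_lower_end_point[OF H] spectral_measureD(4)[OF H] unfolding w\<^sub>0(1)[symmetric]
    proof eventually_elim
      case (elim w)
      define r where "r = (w - w\<^sub>0) / (1 - w\<^sub>0)"
      have "r > 0" using elim w\<^sub>0(2) by (auto simp: r_def)
      have "((\<lambda>v. (1 - w) * (\<zeta> v / v)) \<longlongrightarrow> (1 - w) * 0) at_top"
        by (intro tendsto_intros \<zeta>)
      hence "\<forall>\<^sub>F v in at_top. (1 - w) * (\<zeta> v / v) < r"
        using \<open>r > 0\<close> by (intro order_tendstoD(2)) auto
      hence "\<forall>\<^sub>F v in at_top. ?d v w = 0"
        using eventually_gt_at_top[of 0]
      proof eventually_elim
        case (elim v)
        hence "(1 - w) * \<zeta> v \<le> r * v" by (simp add: field_simps)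
        hence "(1 - w) * y v - w * v \<le> 0"
          using w\<^sub>0(2) unfolding y_def by (subst excess_kernel_from_edge) (auto simp: r_def)
        moreover have "w * \<epsilon> \<ge> 0" using \<open>0 \<le> w \<and> w \<le> 1\<close> \<open>\<epsilon> \<ge> 0\<close> by simp
        ultimately show ?case unfolding distrib_left by linarith
      qed
      thus ?case by (rule tendsto_eventually)
    qed
    have "norm (?d v w) \<le> \<epsilon>" if "0 \<le> w \<and> w \<le> 1" for v w
    proof -
      have "0 \<le> w * \<epsilon>" "w * \<epsilon> \<le> 1 * \<epsilon>"
        using that \<open>\<epsilon> \<ge> 0\<close> by (simp, intro mult_right_mono) auto
      thus ?thesis unfolding distrib_left real_norm_def by linarith
    qed
    hence "AE w in H. norm (?d v w) \<le> \<epsilon>" for v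
      using spectral_measureD(4)[OF H] by (rule eventually_mono[rotated])
    thus "\<forall>\<^sub>F v in at_top. AE w in H. norm (?d v w) \<le> \<epsilon>" by simp
  qed auto
  moreover have "(LINT w|H. ?d v w) = excess H v (y v) - excess H (v + \<epsilon>) (y v)" for v
    unfolding excess_def by (intro Bochner_Integration.integral_diff integrable_excess[OF H])
  ultimately show ?thesis by (simp add: y_def)
qed

text \<open>Below the line of slope \<open>w\<^sub>0 / (1 - w\<^sub>0)\<close> the kernel is nonpositive at every \<open>w \<ge> w\<^sub>0\<close>.\<close>

lemma excess_below_edge:
  assumes H: "spectral_measure H" and w\<^sub>0: "w\<^sub>0 = lower_end_point H" "w\<^sub>0 < 1" and "x \<ge> 0" "\<zeta> \<le> 0"
  shows "excess H x (w\<^sub>0 / (1 - w\<^sub>0) * x + \<zeta>) = 0"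
proof -
  have "excess H x (w\<^sub>0 / (1 - w\<^sub>0) * x + \<zeta>) = (LINT w|H. 0)"
    unfolding excess_def
  proof (rule integral_cong_AE)
    show "AE w in H. max 0 ((1 - w) * (w\<^sub>0 / (1 - w\<^sub>0) * x + \<zeta>) - w * x) = 0"
      using AE_ge_lower_end_point[OF H] spectral_measureD(4)[OF H] unfolding w\<^sub>0(1)[symmetric]
    proof eventually_elim
      case (elim w)
      have "(1 - w) * \<zeta> \<le> 0" "(w - w\<^sub>0) / (1 - w\<^sub>0) * x \<ge> 0"
        using elim \<open>x \<ge> 0\<close> \<open>\<zeta> \<le> 0\<close> w\<^sub>0(2) by (auto simp: mult_le_0_iff)
      thus ?case using w\<^sub>0(2) by (subst excess_kernel_from_edge) auto
    qed
  qed (auto simp: measurable_cong_sets[OF spectral_measureD(2)[OF H] refl])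
  thus ?thesis by simp
qed

section \<open>The norming function of the case without an atom\<close>

definition norming_arg :: "real \<Rightarrow> real \<Rightarrow> real" where
  "norming_arg t x = x powr (- 1 / (t + 2))"

definition norming :: "(real \<Rightarrow> real) \<Rightarrow> real \<Rightarrow> real \<Rightarrow> real" where
  "norming L t x = x powr ((t + 1) / (t + 2)) * L (norming_arg t x) powr (- 1 / (t + 2))"

lemma norming_arg_at_right_0:
  assumes "t > -1"
  shows "filterlim (norming_arg t) (at_right 0) at_top"
proof -
  have "(norming_arg t \<longlongrightarrow> 0) at_top"
    unfolding norming_arg_def using assms by (intro tendsto_neg_powr filterlim_ident) auto
  moreover have "\<forall>\<^sub>F x in at_top. norming_arg t x > 0"
    using eventually_gt_at_top[of 0] by eventually_elim (simp add: norming_arg_def)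
  ultimately show ?thesis by (auto simp: filterlim_at elim: eventually_mono)
qed

lemma ln_norming_arg: "x > 0 \<Longrightarrow> ln (norming_arg t x) = - ln x / (t + 2)"
  by (simp add: norming_arg_def ln_powr)

lemma ln_norming:
  assumes "x > 0" "L (norming_arg t x) > 0"
  shows "norming L t x > 0" and "ln (norming L t x) = (t + 1) / (t + 2) * ln x - ln (L (norming_arg t x)) / (t + 2)"
  using assms by (simp_all add: norming_def ln_mult ln_powr)

text \<open>This is the form \<open>w * L w powr (- \<tau>)\<close> with \<open>\<tau> = 1 / (t + 2)\<close> in which the norming meets the
  hypothesis on \<open>L\<close>.\<close>

lemma norming_over_ident:
  assumes "t > -1" "x > 0" "L (norming_arg t x) > 0"
  shows "norming L t x / x = norming_arg t x * L (norming_arg t x) powr (- (1 / (t + 2)))"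
proof -
  have "x powr ((t + 1) / (t + 2)) = x * norming_arg t x"
  proof -
    have "x * norming_arg t x = x powr (1 + - 1 / (t + 2))"
      using assms by (subst powr_add) (simp add: norming_arg_def)
    also have "1 + - 1 / (t + 2) = (t + 1) / (t + 2)" using assms by (simp add: field_simps)
    finally show ?thesis by simp
  qed
  thus ?thesis using assms by (simp add: norming_def)
qed

context
  fixes L :: "real \<Rightarrow> real" and t \<delta>\<^sub>0 :: real
  assumes L: "slowly_varying_at_0 L"
    and meas: "L \<in> borel_measurable (restrict_space borel {0<..<\<delta>\<^sub>0})" and \<delta>\<^sub>0: "\<delta>\<^sub>0 > 0"
    and t: "t > -1"
begin

lemma L_norming_arg_pos: "\<forall>\<^sub>F x in at_top. L (norming_arg t x) > 0"
  by (rule eventually_compose_filterlim[OF slowly_varying_pos[OF L] norming_arg_at_right_0[OF t]])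

lemma ln_L_norming_arg:
  assumes "\<delta> > 0"
  shows "\<forall>\<^sub>F x in at_top. \<bar>ln (L (norming_arg t x))\<bar> \<le> \<delta> * ln x"
proof -
  have "\<delta> * (t + 2) > 0" using assms t by simp
  from eventually_compose_filterlim[OF slowly_varying_ln_bound[OF L meas \<delta>\<^sub>0 this] norming_arg_at_right_0[OF t]]
    eventually_gt_at_top[of 0]
  show ?thesis by eventually_elim (use t in \<open>simp add: ln_norming_arg\<close>)
qed

lemma norming_pos: "\<forall>\<^sub>F x in at_top. norming L t x > 0"
  using L_norming_arg_pos eventually_gt_at_top[of 0] by eventually_elim (rule ln_norming)

text \<open>The power \<open>(t + 1) / (t + 2)\<close> is positive, and \<open>L\<close> can spoil at most half of it.\<close>

lemma norming_at_top: "filterlim (norming L t) at_top at_top"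
proof -
  define \<gamma> where "\<gamma> = (t + 1) / (t + 2)"
  have "\<gamma> > 0" using t by (simp add: \<gamma>_def)
  have "\<gamma> * (t + 2) / 2 > 0" using \<open>\<gamma> > 0\<close> t by simp
  have "\<forall>\<^sub>F x in at_top. x powr (\<gamma> / 2) \<le> norming L t x"
    using ln_L_norming_arg[OF \<open>\<gamma> * (t + 2) / 2 > 0\<close>] L_norming_arg_pos eventually_gt_at_top[of 0]
  proof eventually_elim
    case (elim x)
    have "ln (L (norming_arg t x)) / (t + 2) \<le> \<gamma> / 2 * ln x"
      using elim t by (simp add: field_simps)
    hence "\<gamma> / 2 * ln x \<le> ln (norming L t x)"
      using ln_norming(2)[of x L t] elim unfolding \<gamma>_def[symmetric] by (simp add: field_simps)
    hence "ln (x powr (\<gamma> / 2)) \<le> ln (norming L t x)" using elim by (simp add: ln_powr)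
    thus ?case using elim ln_norming(1)[of x L t] by (subst (asm) ln_le_cancel_iff) auto
  qed
  moreover have "filterlim (\<lambda>x::real. x powr (\<gamma> / 2)) at_top at_top"
    using \<open>\<gamma> > 0\<close> by real_asymp
  ultimately show ?thesis by (rule filterlim_at_top_mono[rotated])
qed

lemma norming_over_ident_at_right_0: "filterlim (\<lambda>x. norming L t x / x) (at_right 0) at_top"
proof -
  have pos: "\<forall>\<^sub>F x in at_top. norming L t x / x > 0"
    using norming_pos eventually_gt_at_top[of 0] by eventually_elim simp
  have "\<forall>\<^sub>F x in at_top. norming L t x / x \<le> x powr (- 1 / (2 * (t + 2)))"
    using ln_L_norming_arg[OF half_gt_zero[OF zero_less_one]] L_norming_arg_pos eventually_gt_at_top[of 0]
  proof eventually_elim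
    case (elim x)
    define r where "r = 1 / (t + 2)"
    have "r > 0" using t by (simp add: r_def)
    have frac: "(t + 1) / (t + 2) = 1 - r" using t by (simp add: r_def field_simps)
    have "ln (norming L t x / x) = ln (norming L t x) - ln x"
      using elim ln_norming(1)[of x L t] by (subst ln_divide_pos) auto
    also have "ln (norming L t x) = (1 - r) * ln x - r * ln (L (norming_arg t x))"
      using ln_norming(2)[of x L t] elim unfolding frac by (simp add: r_def)
    also have "(1 - r) * ln x - r * ln (L (norming_arg t x)) - ln x = r * (- ln x - ln (L (norming_arg t x)))"
      by (simp add: algebra_simps)
    also have "\<dots> \<le> r * (- (ln x / 2))"
      using elim \<open>r > 0\<close> by (intro mult_left_mono) auto
    also have "\<dots> = ln (x powr (- (r / 2)))"
      using elim by (simp add: ln_powr)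
    also have "- (r / 2) = - 1 / (2 * (t + 2))"
      by (simp add: r_def)
    finally show ?case using elim ln_norming(1)[of x L t] by (subst (asm) ln_le_cancel_iff) auto
  qed
  moreover have "((\<lambda>x. x powr (- 1 / (2 * (t + 2)))) \<longlongrightarrow> 0) at_top"
    using t by (intro tendsto_neg_powr filterlim_ident) auto
  ultimately have "((\<lambda>x. norming L t x / x) \<longlongrightarrow> 0) at_top"
    by (rule tendsto_sandwich[where f = "\<lambda>_. 0", rotated, OF _ tendsto_const])
       (use pos in \<open>auto elim: eventually_mono\<close>)
  thus ?thesis using pos by (auto simp: filterlim_at elim: eventually_mono)
qed

text \<open>In logarithms, \<open>ln x\<close> varies by at most \<open>1 / v\<close> over the interval, and the contribution of \<open>L\<close> is
  controlled by the Potter bound since neighbouring points have neighbouring arguments.\<close>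

lemma norming_locally_constant:
  assumes "\<eta> > 0"
  shows "\<forall>\<^sub>F v in at_top. \<forall>x\<in>{v<..v + 1}. \<bar>norming L t x - norming L t v\<bar> \<le> \<eta> * norming L t v"
proof -
  \<comment> \<open>The logarithm of the norming will vary by at most \<open>3 * \<delta>\<close>.\<close>
  define \<delta> where "\<delta> = ln (1 + \<eta>) / 4"
  have "\<delta> > 0" using assms by (simp add: \<delta>_def)
  have ln_\<eta>: "ln (1 + \<eta>) = 4 * \<delta>" by (simp add: \<delta>_def)
  obtain s\<^sub>0 where s\<^sub>0: "s\<^sub>0 > 0" "\<And>s. 0 < s \<Longrightarrow> s \<le> s\<^sub>0 \<Longrightarrow> L s > 0"
    "\<And>s s'. 0 < s' \<Longrightarrow> s' \<le> s \<Longrightarrow> s \<le> s\<^sub>0 \<Longrightarrow> \<bar>ln (L s') - ln (L s)\<bar> \<le> \<delta> * (1 + ln (s / s'))"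
    using slowly_varying_potter[OF L meas \<delta>\<^sub>0 \<open>\<delta> > 0\<close>] by metis
  have "\<forall>\<^sub>F v in at_top. norming_arg t v < s\<^sub>0"
    using norming_arg_at_right_0[OF t] s\<^sub>0(1) unfolding filterlim_at by (auto intro: order_tendstoD(2))
  thus ?thesis
    using eventually_ge_at_top[of "1 / \<delta>"] eventually_ge_at_top[of 1]
  proof eventually_elim
    case (elim v)
    show ?case
    proof
      fix x assume "x \<in> {v<..v + 1}"
      hence x: "v < x" "x \<le> v + 1" by auto
      have "x > 0" "v > 0" using x elim by auto
      define d where "d = ln x - ln v"
      have "x / v \<le> 1 + 1 / v" using x \<open>v > 0\<close> by (simp add: field_simps)
      hence "ln (x / v) \<le> 1 / v"
        using ln_le_minus_one[of "x / v"] x \<open>v > 0\<close> by simp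
      moreover have "1 / v \<le> \<delta>" using elim \<open>\<delta> > 0\<close> \<open>v > 0\<close> by (simp add: field_simps)
      ultimately have d: "0 \<le> d" "d \<le> \<delta>"
        using x \<open>v > 0\<close> by (auto simp: d_def ln_div)
      have "1 / v \<le> 1" using elim by simp
      with \<open>ln (x / v) \<le> 1 / v\<close> have "ln (x / v) \<le> 1" by linarith
      hence "d \<le> 1" using x \<open>v > 0\<close> by (simp add: d_def ln_div)
      have arg: "0 < norming_arg t x" "norming_arg t x \<le> norming_arg t v"
        using x \<open>v > 0\<close> t by (auto simp: norming_arg_def intro!: powr_mono2')
      have L_pos: "L (norming_arg t x) > 0" "L (norming_arg t v) > 0"
        using arg elim by (auto intro!: s\<^sub>0(2))
      have "ln (norming_arg t v / norming_arg t x) = d / (t + 2)"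
        using arg \<open>x > 0\<close> \<open>v > 0\<close> by (simp add: ln_divide_pos ln_norming_arg d_def diff_divide_distrib)
      hence L_close: "\<bar>ln (L (norming_arg t x)) - ln (L (norming_arg t v))\<bar> \<le> \<delta> * (1 + d / (t + 2))"
        using s\<^sub>0(3)[OF arg] elim by simp
      have "d / (t + 2) \<le> 1" using d \<open>d \<le> 1\<close> t by (simp add: divide_le_eq)
      hence "\<delta> * (1 + d / (t + 2)) \<le> \<delta> * 2" using \<open>\<delta> > 0\<close> by (intro mult_left_mono) auto
      hence L_close2: "\<bar>ln (L (norming_arg t x)) - ln (L (norming_arg t v))\<bar> \<le> 2 * \<delta>" using L_close by linarith
      have "ln (norming L t x) - ln (norming L t v) =
          (t + 1) / (t + 2) * d - (ln (L (norming_arg t x)) - ln (L (norming_arg t v))) / (t + 2)"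
        using ln_norming(2)[of x L t, OF \<open>x > 0\<close> L_pos(1)] ln_norming(2)[of v L t, OF \<open>v > 0\<close> L_pos(2)]
        by (simp add: d_def diff_divide_distrib algebra_simps)
      moreover have "\<bar>(t + 1) / (t + 2) * d\<bar> \<le> 1 * d"
        unfolding abs_mult using t d by (intro mult_mono) auto
      moreover have "\<bar>(ln (L (norming_arg t x)) - ln (L (norming_arg t v))) / (t + 2)\<bar> \<le> 2 * \<delta>"
        unfolding abs_divide using t L_close2 \<open>\<delta> > 0\<close> 
        by (subst divide_le_eq) (auto intro!: order_trans[OF L_close2])
      ultimately have "\<bar>ln (norming L t x) - ln (norming L t v)\<bar> \<le> ln (1 + \<eta>)"
        using d \<open>\<delta> > 0\<close> unfolding ln_\<eta> by linarith
      moreover have pos: "norming L t x > 0" "norming L t v > 0"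
        using ln_norming(1) L_pos \<open>x > 0\<close> \<open>v > 0\<close> by auto
      ultimately have "ln (norming L t x) \<le> ln ((1 + \<eta>) * norming L t v)" "ln (norming L t v) \<le> ln ((1 + \<eta>) * norming L t x)"
        using assms by (auto simp: ln_mult_pos)
      hence *: "norming L t x \<le> (1 + \<eta>) * norming L t v" "norming L t v \<le> (1 + \<eta>) * norming L t x"
        using assms pos by (auto simp: ln_le_cancel_iff)
      have "norming L t v - norming L t x \<le> \<eta> * norming L t v"
      proof (cases "norming L t x \<le> norming L t v")
        case True
        hence "\<eta> * norming L t x \<le> \<eta> * norming L t v" using assms by simp
        thus ?thesis using *(2) by (simp add: algebra_simps)
      next
        case False
        moreover have "\<eta> * norming L t v > 0" using assms pos by simp
        ultimately show ?thesis by linarith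
      qed
      thus "\<bar>norming L t x - norming L t v\<bar> \<le> \<eta> * norming L t v"
        using *(1) by (simp add: algebra_simps abs_le_iff)
    qed
  qed
qed

text \<open>The window \<open>S v\<close> is asymptotic to a multiple of \<open>\<sigma> v = norming L t v / v\<close>, which is
  \<open>w * L w powr (- 1 / (t + 2))\<close> at \<open>w = norming_arg t v\<close>. Hence \<open>L (S v)\<close>, \<open>L (\<sigma> v)\<close> and
  \<open>L (norming_arg t v)\<close> are asymptotically equal, the first pair by slow variation and the second by
  hypothesis. The norming satisfies
  \<open>norming L t v powr (t + 2) * L (norming_arg t v) = v powr (t + 1)\<close>, so all factors of \<open>L\<close> cancel
  and a power of \<open>v / D v \<longrightarrow> 1 - w\<^sub>0\<close> remains.\<close>

lemma excess_limit_regular: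
  assumes H: "spectral_measure H" and w\<^sub>0: "w\<^sub>0 = lower_end_point H" "w\<^sub>0 < 1" "w\<^sub>0 < w\<^sub>1"
    and no_atom: "measure H {w\<^sub>0} = 0" and dens: "has_density_off {w\<^sub>0, w\<^sub>1} H h"
    and h: "((\<lambda>s. h (w\<^sub>0 + s) / (L s * s powr t)) \<longlongrightarrow> 1) (at_right 0)"
    and shift: "((\<lambda>w. L (w * L w powr (- (1 / (t + 2)))) / L w) \<longlongrightarrow> 1) (at_right 0)"
    and "z > 0"
  shows "((\<lambda>v. excess H v (w\<^sub>0 / (1 - w\<^sub>0) * v + z * norming L t v)) \<longlongrightarrow>
           (1 - w\<^sub>0) powr (3 + 2 * t) * z powr (t + 2) / ((t + 1) * (t + 2))) at_top"
proof -
  have [measurable]: "h \<in> borel_measurable borel"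
    using dens by (simp add: has_density_off_def)
  define K where "K = (\<lambda>S. LINT l|lborel. indicator {0..1} l * ((1 - l) * h (w\<^sub>0 + S * l)))"
  have K: "((\<lambda>S. K S / (L S * S powr t)) \<longlongrightarrow> 1 / ((t + 1) * (t + 2))) (at_right 0)"
    unfolding K_def by (rule karamata_weighted[OF L meas \<delta>\<^sub>0 _ h t]) measurable
  define \<sigma> where "\<sigma> = (\<lambda>v. norming L t v / v)"
  define D where "D = (\<lambda>v. v / (1 - w\<^sub>0) + z * norming L t v)"
  define S where "S = (\<lambda>v. (1 - w\<^sub>0) * (z * norming L t v) / D v)"
  note \<sigma> = norming_over_ident_at_right_0[folded \<sigma>_def]
  hence \<sigma>_0: "(\<sigma> \<longlongrightarrow> 0) at_top" by (simp add: filterlim_at)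
  have D_pos: "\<forall>\<^sub>F v in at_top. D v > 0"
    using norming_pos eventually_gt_at_top[of 0]
    by eventually_elim (use w\<^sub>0 \<open>z > 0\<close> in \<open>auto simp: D_def intro!: add_pos_pos\<close>)
  have vD: "((\<lambda>v. v / D v) \<longlongrightarrow> 1 - w\<^sub>0) at_top"
  proof -
    have "((\<lambda>v. 1 / (1 / (1 - w\<^sub>0) + z * \<sigma> v)) \<longlongrightarrow> 1 / (1 / (1 - w\<^sub>0) + z * 0)) at_top"
      using w\<^sub>0(2) by (intro tendsto_intros \<sigma>_0) auto
    moreover have "\<forall>\<^sub>F v in at_top. 1 / (1 / (1 - w\<^sub>0) + z * \<sigma> v) = v / D v"
      using eventually_gt_at_top[of 0] D_pos
    proof eventually_elim
      case (elim v)
      have "D v = v * (1 / (1 - w\<^sub>0) + z * \<sigma> v)" using elim by (simp add: D_def \<sigma>_def field_simps)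
      thus ?case using elim by simp
    qed
    ultimately show ?thesis by (auto intro: Lim_transform_eventually)
  qed
  have S_\<sigma>: "((\<lambda>v. S v / \<sigma> v) \<longlongrightarrow> (1 - w\<^sub>0) * z * (1 - w\<^sub>0)) at_top"
  proof -
    have "((\<lambda>v. (1 - w\<^sub>0) * z * (v / D v)) \<longlongrightarrow> (1 - w\<^sub>0) * z * (1 - w\<^sub>0)) at_top"
      by (intro tendsto_intros vD)
    moreover have "\<forall>\<^sub>F v in at_top. (1 - w\<^sub>0) * z * (v / D v) = S v / \<sigma> v"
      using norming_pos eventually_gt_at_top[of 0]
      by eventually_elim (auto simp: S_def \<sigma>_def)
    ultimately show ?thesis by (rule Lim_transform_eventually)
  qed
  have S_pos: "\<forall>\<^sub>F v in at_top. S v > 0"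
    using norming_pos D_pos by eventually_elim (use w\<^sub>0 \<open>z > 0\<close> in \<open>auto simp: S_def\<close>)
  have S_0: "(S \<longlongrightarrow> 0) at_top"
  proof -
    have "((\<lambda>v. S v / \<sigma> v * \<sigma> v) \<longlongrightarrow> (1 - w\<^sub>0) * z * (1 - w\<^sub>0) * 0) at_top"
      by (intro tendsto_mult S_\<sigma> \<sigma>_0)
    moreover have "\<forall>\<^sub>F v in at_top. S v / \<sigma> v * \<sigma> v = S v"
      using \<sigma> by (auto simp: filterlim_at elim: eventually_mono)
    ultimately show ?thesis by (auto intro: Lim_transform_eventually)
  qed
  have S: "filterlim S (at_right 0) at_top"
    using S_0 S_pos by (auto simp: filterlim_at elim: eventually_mono)
  have "((\<lambda>v. L (S v) / L (\<sigma> v)) \<longlongrightarrow> 1) at_top"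
    by (rule slowly_varying_ratio[OF L meas \<delta>\<^sub>0 \<sigma> S_\<sigma>]) (use w\<^sub>0 \<open>z > 0\<close> in auto)
  moreover have "((\<lambda>v. L (\<sigma> v) / L (norming_arg t v)) \<longlongrightarrow> 1) at_top"
  proof (rule Lim_transform_eventually[OF filterlim_compose[OF shift norming_arg_at_right_0[OF t]]])
    show "\<forall>\<^sub>F v in at_top. L (norming_arg t v * L (norming_arg t v) powr (- (1 / (t + 2)))) / L (norming_arg t v) =
        L (\<sigma> v) / L (norming_arg t v)"
      using L_norming_arg_pos eventually_gt_at_top[of 0]
      by eventually_elim (simp add: \<sigma>_def norming_over_ident[OF t])
  qed
  ultimately have "((\<lambda>v. (L (S v) / L (\<sigma> v)) * (L (\<sigma> v) / L (norming_arg t v))) \<longlongrightarrow> 1 * 1) at_top"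
    by (rule tendsto_mult)
  moreover have "\<forall>\<^sub>F v in at_top. L (\<sigma> v) > 0"
    by (rule eventually_compose_filterlim[OF slowly_varying_pos[OF L] \<sigma>])
  hence "\<forall>\<^sub>F v in at_top. (L (S v) / L (\<sigma> v)) * (L (\<sigma> v) / L (norming_arg t v)) = L (S v) / L (norming_arg t v)"
    by eventually_elim simp
  ultimately have L_ratio: "((\<lambda>v. L (S v) / L (norming_arg t v)) \<longlongrightarrow> 1) at_top"
    by (auto intro: Lim_transform_eventually)
  have "((\<lambda>v. ((1 - w\<^sub>0) * z) powr (t + 2) * (v / D v) powr (t + 1) * (L (S v) / L (norming_arg t v)) *
           (K (S v) / (L (S v) * S v powr t))) \<longlongrightarrow>
         ((1 - w\<^sub>0) * z) powr (t + 2) * (1 - w\<^sub>0) powr (t + 1) * 1 * (1 / ((t + 1) * (t + 2)))) at_top"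
    using w\<^sub>0(2) by (intro tendsto_mult tendsto_const tendsto_powr vD L_ratio filterlim_compose[OF K S]) auto
  also have "((1 - w\<^sub>0) * z) powr (t + 2) * (1 - w\<^sub>0) powr (t + 1) * 1 * (1 / ((t + 1) * (t + 2))) =
      (1 - w\<^sub>0) powr (3 + 2 * t) * z powr (t + 2) / ((t + 1) * (t + 2))"
  proof -
    have "(1 - w\<^sub>0) powr (3 + 2 * t) = (1 - w\<^sub>0) powr ((t + 2) + (t + 1))" by (simp add: algebra_simps)
    also have "\<dots> = (1 - w\<^sub>0) powr (t + 2) * (1 - w\<^sub>0) powr (t + 1)" by (rule powr_add)
    finally have "(1 - w\<^sub>0) powr (3 + 2 * t) = (1 - w\<^sub>0) powr (t + 2) * (1 - w\<^sub>0) powr (t + 1)" .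
    moreover have "((1 - w\<^sub>0) * z) powr (t + 2) = (1 - w\<^sub>0) powr (t + 2) * z powr (t + 2)"
      using w\<^sub>0 \<open>z > 0\<close> by (simp add: powr_mult)
    ultimately show ?thesis by simp
  qed
  finally show ?thesis
  proof (rule Lim_transform_eventually)
    have "\<forall>\<^sub>F v in at_top. S v < w\<^sub>1 - w\<^sub>0" using S_0 w\<^sub>0(3) by (intro order_tendstoD(2)) auto
    moreover have "\<forall>\<^sub>F v in at_top. L (S v) > 0"
      by (rule eventually_compose_filterlim[OF slowly_varying_pos[OF L] S])
    ultimately show "\<forall>\<^sub>F v in at_top.
        ((1 - w\<^sub>0) * z) powr (t + 2) * (v / D v) powr (t + 1) * (L (S v) / L (norming_arg t v)) *
          (K (S v) / (L (S v) * S v powr t)) = excess H v (w\<^sub>0 / (1 - w\<^sub>0) * v + z * norming L t v)"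
      using L_norming_arg_pos norming_pos D_pos S_pos eventually_gt_at_top[of 0]
    proof eventually_elim
      case (elim v)
      have "excess H v (w\<^sub>0 / (1 - w\<^sub>0) * v + z * norming L t v) = D v * (S v)\<^sup>2 * K (S v)"
        unfolding K_def S_def D_def
        by (rule excess_eq_density_integral[OF H w\<^sub>0(1,2) no_atom dens])
           (use elim \<open>z > 0\<close> in \<open>auto simp: S_def D_def\<close>)
      moreover have "D v * (S v)\<^sup>2 * S v powr t * L (norming_arg t v) =
          ((1 - w\<^sub>0) * z) powr (t + 2) * (v / D v) powr (t + 1)"
      proof -
        have "(S v)\<^sup>2 * S v powr t = S v powr (t + 2)"
          using elim by (simp add: powr_add powr_numeral)
        also have "\<dots> = ((1 - w\<^sub>0) * z) powr (t + 2) * norming L t v powr (t + 2) / D v powr (t + 2)"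
          using elim w\<^sub>0 \<open>z > 0\<close> by (simp add: S_def powr_divide powr_mult mult.assoc)
        also have "norming L t v powr (t + 2) = v powr (t + 1) / L (norming_arg t v)"
        proof -
          have "(t + 1) / (t + 2) * (t + 2) = t + 1" "- 1 / (t + 2) * (t + 2) = - 1"
            using t by simp_all
          thus ?thesis
            using elim by (simp only: norming_def powr_mult powr_powr) (simp add: powr_minus divide_inverse)
        qed
        finally have "(S v)\<^sup>2 * S v powr t =
          ((1 - w\<^sub>0) * z) powr (t + 2) * (v powr (t + 1) / L (norming_arg t v)) / D v powr (t + 2)" .
        moreover have "D v powr (t + 2) = D v * D v powr (t + 1)"
          using elim powr_add[of "D v" 1 "t + 1"] by (simp add: add.commute)
        moreover have "D v * (S v)\<^sup>2 * S v powr t * L (norming_arg t v) =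
            D v * ((S v)\<^sup>2 * S v powr t) * L (norming_arg t v)"
          by (simp only: mult.assoc)
        moreover have "(v / D v) powr (t + 1) = v powr (t + 1) / D v powr (t + 1)"
          using elim by (simp add: powr_divide)
        ultimately show ?thesis
          using elim by simp
      qed
      ultimately have "((1 - w\<^sub>0) * z) powr (t + 2) * (v / D v) powr (t + 1) * (L (S v) / L (norming_arg t v)) *
            (K (S v) / (L (S v) * S v powr t)) =
          (D v * (S v)\<^sup>2 * S v powr t * L (norming_arg t v)) * (L (S v) / L (norming_arg t v)) *
            (K (S v) / (L (S v) * S v powr t))"
          and "excess H v (w\<^sub>0 / (1 - w\<^sub>0) * v + z * norming L t v) = D v * (S v)\<^sup>2 * K (S v)"
        by simp_all
      thus ?case
        using elim by simp
    qed
  qed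
qed

text \<open>Unit strips suffice: both the slope term, at most \<open>c \<le> 1\<close>, and the variation of the norming are small
  compared to \<open>norming L t v\<close>, so levels \<open>c v + (z \<plusminus> d) norming L t v\<close> enclose the curve; \<open>d\<close> is
  then taken small by continuity of the limit in \<open>z\<close>. The function \<open>b\<close> is allowed to differ from the
  norming on a bounded set so that it can be chosen Borel.\<close>

lemma strip_approximable_regular:
  assumes H: "spectral_measure H"
    and w\<^sub>0: "w\<^sub>0 = lower_end_point H" "0 \<le> w\<^sub>0" "w\<^sub>0 < 1 / 2" "w\<^sub>0 < w\<^sub>1"
    and no_atom: "measure H {w\<^sub>0} = 0" and dens: "has_density_off {w\<^sub>0, w\<^sub>1} H h"
    and h: "((\<lambda>s. h (w\<^sub>0 + s) / (L s * s powr t)) \<longlongrightarrow> 1) (at_right 0)"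
    and shift: "((\<lambda>w. L (w * L w powr (- (1 / (t + 2)))) / L w) \<longlongrightarrow> 1) (at_right 0)"
    and b: "\<forall>\<^sub>F x in at_top. b x = norming L t x" and "z \<noteq> 0"
  shows "strip_approximable H (\<lambda>x. w\<^sub>0 / (1 - w\<^sub>0) * x + z * b x)
    (if z < 0 then 1 else exp (- ((1 - w\<^sub>0) powr (3 + 2 * t) * z powr (t + 2) / ((t + 1) * (t + 2)))))"
proof -
  have "w\<^sub>0 < 1" using w\<^sub>0 by simp
  define c where "c = w\<^sub>0 / (1 - w\<^sub>0)"
  have c: "0 \<le> c" "c \<le> 1" using w\<^sub>0 by (auto simp: c_def field_simps)
  define \<Psi> where "\<Psi> = (\<lambda>z. (1 - w\<^sub>0) powr (3 + 2 * t) * max 0 z powr (t + 2) / ((t + 1) * (t + 2)))"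
  have q_eq: "(if z < 0 then 1 else exp (- ((1 - w\<^sub>0) powr (3 + 2 * t) * z powr (t + 2) / ((t + 1) * (t + 2))))) =
      exp (- \<Psi> z)"
    by (simp add: \<Psi>_def max_absorb1 max_absorb2)
  have excess_lim: "((\<lambda>v. excess H v (c * v + \<zeta> * norming L t v)) \<longlongrightarrow> \<Psi> \<zeta>) at_top" for \<zeta>
  proof (cases "\<zeta> > 0")
    case True
    show ?thesis
      using excess_limit_regular[OF H w\<^sub>0(1) \<open>w\<^sub>0 < 1\<close> w\<^sub>0(4) no_atom dens h shift True] True
      by (simp add: \<Psi>_def c_def)
  next
    case False
    have "\<forall>\<^sub>F v in at_top. excess H v (c * v + \<zeta> * norming L t v) = 0"
      using norming_pos eventually_ge_at_top[of 0]
    proof eventually_elim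
      case (elim v)
      show ?case unfolding c_def
        by (rule excess_below_edge[OF H w\<^sub>0(1) \<open>w\<^sub>0 < 1\<close>])
           (use elim False in \<open>auto simp: mult_le_0_iff\<close>)
    qed
    thus ?thesis using False by (auto simp: \<Psi>_def max_absorb1 intro: tendsto_eventually)
  qed
  have strip_lim: "((\<lambda>v. strip H 1 v (c * v + \<zeta> * norming L t v)) \<longlongrightarrow> exp (- \<Psi> \<zeta>) * (1 - exp (- 1))) at_top" for \<zeta>
  proof -
    let ?y = "\<lambda>v. c * v + \<zeta> * norming L t v"
    have "((\<lambda>v. \<zeta> * (norming L t v / v)) \<longlongrightarrow> \<zeta> * 0) at_top"
      using norming_over_ident_at_right_0 by (intro tendsto_mult tendsto_const) (simp add: filterlim_at)
    hence "((\<lambda>v. excess H v (?y v) - excess H (v + 1) (?y v)) \<longlongrightarrow> 0) at_top"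
      unfolding c_def by (intro excess_step_vanishes[OF H w\<^sub>0(1) \<open>w\<^sub>0 < 1\<close> no_atom]) auto
    from tendsto_diff[OF excess_lim[of \<zeta>] this]
    have "((\<lambda>v. excess H (v + 1) (?y v)) \<longlongrightarrow> \<Psi> \<zeta>) at_top" by simp
    hence "((\<lambda>v. strip H 1 v (?y v)) \<longlongrightarrow> exp (- \<Psi> \<zeta>) - exp (- 1) * exp (- \<Psi> \<zeta>)) at_top"
      unfolding strip_def by (intro tendsto_intros excess_lim)
    thus ?thesis by (simp add: algebra_simps)
  qed
  have "continuous_on UNIV (\<lambda>z. exp (- \<Psi> z))"
  proof -
    have "continuous_on UNIV (\<lambda>z::real. max 0 z powr (t + 2))"
      using t by (intro continuous_on_powr' continuous_on_max continuous_on_const continuous_on_id) auto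
    thus ?thesis
      unfolding \<Psi>_def using t
      by (intro continuous_on_exp continuous_on_minus continuous_on_divide continuous_on_mult continuous_on_const) auto
  qed
  hence cont: "((\<lambda>\<zeta>. exp (- \<Psi> \<zeta>)) \<longlongrightarrow> exp (- \<Psi> z)) (nhds z)"
    by (simp add: continuous_on_def tendsto_nhds_iff)
  have "strip_approximable H (\<lambda>x. c * x + z * b x) (exp (- \<Psi> z))"
    unfolding strip_approximable_def
  proof (intro allI impI, goal_cases)
    case (1 \<eta>)
    have "\<forall>\<^sub>F \<zeta> in nhds z. exp (- \<Psi> \<zeta>) < exp (- \<Psi> z) + \<eta> \<and> exp (- \<Psi> z) - \<eta> < exp (- \<Psi> \<zeta>)"
      using 1 by (intro eventually_conj order_tendstoD[OF cont]) auto
    then obtain d' where d': "d' > 0"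
      "\<And>\<zeta>. dist \<zeta> z < d' \<Longrightarrow> exp (- \<Psi> \<zeta>) < exp (- \<Psi> z) + \<eta> \<and> exp (- \<Psi> z) - \<eta> < exp (- \<Psi> \<zeta>)"
      unfolding eventually_nhds_metric by blast
    define d where "d = d' / 2"
    have "d > 0" using d' by (simp add: d_def)
    have A: "exp (- \<Psi> (z - d)) < exp (- \<Psi> z) + \<eta>" and B: "exp (- \<Psi> z) - \<eta> < exp (- \<Psi> (z + d))"
      using d'(2)[of "z - d"] d'(2)[of "z + d"] \<open>d > 0\<close> by (auto simp: dist_real_def d_def)
    \<comment> \<open>Half of the margin \<open>d\<close> goes to the norming, the other half to the slope.\<close>
    define \<eta>' where "\<eta>' = d / 2 / (\<bar>z\<bar> + 1)"
    have "\<eta>' > 0" using \<open>d > 0\<close> by (simp add: \<eta>'_def)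
    have "\<bar>z\<bar> * \<eta>' \<le> (\<bar>z\<bar> + 1) * \<eta>'" using \<open>\<eta>' > 0\<close> by (intro mult_right_mono) auto
    also have "\<dots> = d / 2"
    proof -
      have "\<bar>z\<bar> + 1 \<noteq> 0" by linarith
      from nonzero_mult_div_cancel_left[OF this, of "d / 2"] show ?thesis by (simp only: \<eta>'_def times_divide_eq_right)
    qed
    finally have z\<eta>': "\<bar>z\<bar> * \<eta>' \<le> d / 2" .
    obtain x\<^sub>0 where x\<^sub>0: "\<And>x. x \<ge> x\<^sub>0 \<Longrightarrow> b x = norming L t x"
      using b unfolding eventually_at_top_linorder by blast
    have "\<forall>\<^sub>F v in at_top. 2 / d \<le> norming L t v"
      using norming_at_top by (auto simp: filterlim_at_top)
    hence curve: "\<forall>\<^sub>F v in at_top. \<forall>x\<in>{v<..v + 1}.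
        c * v + (z - d) * norming L t v < c * x + z * b x \<and> c * x + z * b x \<le> c * v + (z + d) * norming L t v"
      using norming_locally_constant[OF \<open>\<eta>' > 0\<close>] norming_pos eventually_ge_at_top[of x\<^sub>0]
    proof eventually_elim
      case (elim v)
      show ?case
      proof
        fix x assume "x \<in> {v<..v + 1}"
        hence x: "v < x" "x \<le> v + 1" by auto
        have "b x = norming L t x" using x\<^sub>0[of x] x elim by simp
        have "\<bar>z * norming L t x - z * norming L t v\<bar> = \<bar>z\<bar> * \<bar>norming L t x - norming L t v\<bar>"
          by (simp add: abs_mult flip: right_diff_distrib)
        also have "\<dots> \<le> \<bar>z\<bar> * (\<eta>' * norming L t v)"
          using elim x by (intro mult_left_mono) auto
        also have "\<dots> \<le> d / 2 * norming L t v"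
          using mult_right_mono[OF z\<eta>', of "norming L t v"] elim by (simp add: mult.assoc)
        finally have "\<bar>z * norming L t x - z * norming L t v\<bar> \<le> d / 2 * norming L t v" .
        moreover have "c * v \<le> c * x" "c * x \<le> c * (v + 1)"
          using x c by (auto intro: mult_left_mono)
        moreover have "1 \<le> d / 2 * norming L t v" using elim(1) \<open>d > 0\<close> by (simp add: field_simps)
        moreover have "d * norming L t v > 0" using \<open>d > 0\<close> elim by simp
        ultimately show "c * v + (z - d) * norming L t v < c * x + z * b x \<and>
            c * x + z * b x \<le> c * v + (z + d) * norming L t v"
          using c unfolding \<open>b x = norming L t x\<close> left_diff_distrib distrib_left distrib_right
          by (intro conjI; linarith)
      qed
    qed
    show ?case
    proof (intro exI conjI)
      show "(0::real) < 1" by simp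
      show "\<forall>\<^sub>F v in at_top. \<forall>x\<in>{v<..v + 1}.
          c * v + (z - d) * norming L t v < c * x + z * b x \<and> c * x + z * b x \<le> c * v + (z + d) * norming L t v"
        by (rule curve)
      show "exp (- \<Psi> (z - d)) * (1 - exp (- 1)) < (exp (- \<Psi> z) + \<eta>) * (1 - exp (- 1))"
        using A by (intro mult_strict_right_mono) auto
      show "(exp (- \<Psi> z) - \<eta>) * (1 - exp (- 1)) < exp (- \<Psi> (z + d)) * (1 - exp (- 1))"
        using B by (intro mult_strict_right_mono) auto
    qed (rule strip_lim)+
  qed
  thus ?thesis unfolding q_eq c_def .
qed

end

section \<open>The two limit laws\<close>

lemma density_ratio_at_edge:
  assumes L: "slowly_varying_at_0 L"
    and h: "h \<sim>[at_right w\<^sub>0] (\<lambda>w. L (w - w\<^sub>0) * (w - w\<^sub>0) powr t)"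
  shows "((\<lambda>s. h (w\<^sub>0 + s) / (L s * s powr t)) \<longlongrightarrow> 1) (at_right 0)"
proof -
  from slowly_varying_pos[OF L] have "\<forall>\<^sub>F s in at_right 0. L s * s powr t \<noteq> 0"
    using eventually_at_right_less[of 0] by eventually_elim auto
  hence "\<forall>\<^sub>F w in at_right w\<^sub>0. h w \<noteq> 0 \<or> L (w - w\<^sub>0) * (w - w\<^sub>0) powr t \<noteq> 0"
    by (subst at_right_to_0) (auto simp: eventually_filtermap elim: eventually_mono)
  with h have "((\<lambda>w. h w / (L (w - w\<^sub>0) * (w - w\<^sub>0) powr t)) \<longlongrightarrow> 1) (at_right w\<^sub>0)"
    by (rule asymp_equivD_strong)
  thus ?thesis
    by (subst (asm) at_right_to_0) (simp add: filterlim_filtermap add.commute)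
qed

text \<open>Since \<open>L\<close> is measurable only near \<open>0\<close>, the norming is measurable only near infinity.\<close>

lemma norming_borel_modification:
  assumes meas: "L \<in> borel_measurable (restrict_space borel {0<..<\<delta>\<^sub>0})" and "\<delta>\<^sub>0 > 0" and "t > -1"
  obtains b where "b \<in> borel_measurable borel" "\<forall>\<^sub>F x in at_top. b x = norming L t x"
proof
  let ?b = "\<lambda>x. x powr ((t + 1) / (t + 2)) *
    (indicator {0<..<\<delta>\<^sub>0} (norming_arg t x) *\<^sub>R L (norming_arg t x)) powr (- 1 / (t + 2))"
  have "(\<lambda>s. indicator {0<..<\<delta>\<^sub>0} s *\<^sub>R L s) \<in> borel_measurable borel"
    using meas by (subst (asm) borel_measurable_restrict_space_iff) auto
  moreover have "norming_arg t \<in> borel_measurable borel"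
    unfolding norming_arg_def by measurable
  ultimately have [measurable]:
    "(\<lambda>x. indicator {0<..<\<delta>\<^sub>0} (norming_arg t x) *\<^sub>R L (norming_arg t x)) \<in> borel_measurable borel"
    by (rule measurable_compose[rotated])
  show "?b \<in> borel_measurable borel" by measurable
  have "\<forall>\<^sub>F x in at_top. norming_arg t x \<in> {0<..<\<delta>\<^sub>0}"
    by (rule eventually_compose_filterlim[OF eventually_at_right_real[OF \<open>\<delta>\<^sub>0 > 0\<close>] norming_arg_at_right_0[OF \<open>t > -1\<close>]])
  thus "\<forall>\<^sub>F x in at_top. ?b x = norming L t x"
    by eventually_elim (simp add: norming_def)
qed

text \<open>Both limits have this shape: \<open>\<rho>\<close> is a multiple of a power and \<open>m = 1\<close>, or \<open>\<rho>\<close> is linear and \<open>1 - m\<close> is the atom at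
  \<open>0\<close>. They are not degenerate because the distribution function stays below \<open>1\<close>.\<close>

lemma exponential_cdf_exists:
  fixes \<rho> :: "real \<Rightarrow> real"
  assumes m: "0 < m" "m \<le> 1" and cont: "continuous_on {0..} \<rho>"
    and mono: "\<And>z z'. 0 \<le> z \<Longrightarrow> z \<le> z' \<Longrightarrow> \<rho> z \<le> \<rho> z'" and "\<rho> 0 = 0"
    and lim: "filterlim \<rho> at_top at_top"
  obtains \<mu> where "real_distribution \<mu>" "nondegenerate \<mu>"
    "cdf \<mu> = (\<lambda>z. if z < 0 then 0 else 1 - m * exp (- \<rho> z))" "measure \<mu> {0} = 1 - m"
proof -
  define F where "F = (\<lambda>z. if z < 0 then 0 else 1 - m * exp (- \<rho> z))"
  have F_mono: "F x \<le> F y" if "x \<le> y" for x y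
  proof -
    have "m * exp (- \<rho> z) \<le> 1" if "z \<ge> 0" for z
      using mult_mono[of m 1 "exp (- \<rho> z)" 1] m mono[of 0 z] \<open>\<rho> 0 = 0\<close> that by simp
    thus ?thesis using mono[of x y] that m by (auto simp: F_def)
  qed
  have F_cont: "continuous (at_right a) F" for a
  proof (cases "a < 0")
    case True
    have "\<forall>\<^sub>F z in at_right a. z \<in> {a<..<0}" using True by (rule eventually_at_right_real)
    hence "\<forall>\<^sub>F z in at_right a. F z = F a" by eventually_elim (use True in \<open>auto simp: F_def\<close>)
    thus ?thesis by (auto simp: continuous_within intro: tendsto_eventually)
  next
    case False
    have "(\<rho> \<longlongrightarrow> \<rho> a) (at a within {0..})"
      using cont False by (simp add: continuous_on_def)
    hence "(\<rho> \<longlongrightarrow> \<rho> a) (at_right a)"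
      by (rule tendsto_within_subset) (use False in auto)
    hence "((\<lambda>z. 1 - m * exp (- \<rho> z)) \<longlongrightarrow> 1 - m * exp (- \<rho> a)) (at_right a)"
      by (intro tendsto_intros)
    moreover have "\<forall>\<^sub>F z in at_right a. 1 - m * exp (- \<rho> z) = F z"
      using eventually_at_right_less[of a] by eventually_elim (use False in \<open>auto simp: F_def\<close>)
    ultimately have "(F \<longlongrightarrow> 1 - m * exp (- \<rho> a)) (at_right a)"
      by (rule Lim_transform_eventually)
    thus ?thesis using False by (simp add: continuous_within F_def)
  qed
  have F_bot: "(F \<longlongrightarrow> 0) at_bot"
    using eventually_gt_at_bot[of 0] by (intro tendsto_eventually) (auto simp: F_def eventually_at_bot_dense)
  have F_top: "(F \<longlongrightarrow> 1) at_top"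
  proof -
    have "((\<lambda>z. exp (- \<rho> z)) \<longlongrightarrow> 0) at_top"
      by (intro filterlim_compose[OF exp_at_bot] filterlim_compose[OF filterlim_uminus_at_bot_at_top lim])
    hence "((\<lambda>z. 1 - m * exp (- \<rho> z)) \<longlongrightarrow> 1 - m * 0) at_top"
      by (intro tendsto_intros)
    moreover have "\<forall>\<^sub>F z in at_top. 1 - m * exp (- \<rho> z) = F z"
      using eventually_ge_at_top[of 0] by eventually_elim (auto simp: F_def)
    ultimately show ?thesis by (auto intro: Lim_transform_eventually)
  qed
  define \<mu> where "\<mu> = interval_measure F"
  interpret \<mu>: real_distribution \<mu>
    unfolding \<mu>_def using F_mono F_cont F_bot F_top by (rule real_distribution_interval_measure)
  have cdf: "cdf \<mu> = F"
    unfolding \<mu>_def using F_mono F_cont F_bot by (rule cdf_interval_measure)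
  have atom: "measure \<mu> {c} \<le> F c" for c
    unfolding cdf[symmetric] cdf_def by (intro \<mu>.finite_measure_mono) auto
  have "F c < 1" for c using m by (simp add: F_def)
  with atom have "nondegenerate \<mu>" unfolding nondegenerate_def by (metis less_irrefl less_le_trans not_le)
  moreover have "measure \<mu> {..<0} = 0"
  proof (rule tendsto_unique[OF _ \<mu>.cdf_at_left])
    have "\<forall>\<^sub>F z in at_left (0::real). z \<in> {-1<..<0}" by (rule eventually_at_left_real) simp
    hence "\<forall>\<^sub>F z in at_left 0. cdf \<mu> z = 0" by eventually_elim (simp add: cdf F_def)
    thus "(cdf \<mu> \<longlongrightarrow> 0) (at_left 0)" by (rule tendsto_eventually)
  qed simp
  moreover have "measure \<mu> {..0} = measure \<mu> {..<0} + measure \<mu> {0}"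
    unfolding ivl_disj_un(2)[symmetric] by (subst \<mu>.finite_measure_Union) auto
  moreover have "measure \<mu> {..0} = 1 - m"
    using fun_cong[OF cdf, of 0] \<open>\<rho> 0 = 0\<close> by (simp add: cdf_def F_def)
  ultimately show ?thesis
    using \<mu>.real_distribution_axioms cdf by (intro that[of \<mu>]) (auto simp: F_def)
qed

theorem corollary1:
  fixes M :: "'a measure" and X Y :: "'a \<Rightarrow> real" and H :: "real measure"
    and h L :: "real \<Rightarrow> real" and t w\<^sub>l w\<^sub>u :: real
  assumes "prob_space M"
    and "spectral_measure H"
    and "inverted_max_stable H M X Y"
    and "w\<^sub>l = lower_end_point H" and "w\<^sub>u = upper_end_point H"
    and "w\<^sub>l \<in> {0..<1/2}" and "w\<^sub>u \<in> {1/2<..1}"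
    and "has_density_off {w\<^sub>l, w\<^sub>u} H h"
    and "t > -1"
    and "slowly_varying_at_0 L"
    and "h \<sim>[at_right w\<^sub>l] (\<lambda>w. L (w - w\<^sub>l) * (w - w\<^sub>l) powr t)"
  shows
    "(measure H {w\<^sub>l} = 0 \<longrightarrow>
      (\<exists>\<delta>>0. L \<in> borel_measurable (restrict_space borel {0<..<\<delta>})) \<longrightarrow>
      (\<forall>\<tau>\<in>{0<..<1}. ((\<lambda>w. L (w * L w powr (- \<tau>)) / L w) \<longlongrightarrow> 1) (at_right 0)) \<longrightarrow>
      (\<exists>\<mu>. real_distribution \<mu> \<and> nondegenerate \<mu> \<and>
        (\<forall>z>0. cdf \<mu> z =
           1 - exp (- ((1 - w\<^sub>l) powr (3 + 2 * t) * z powr (t + 2) / ((t + 1) * (t + 2))))) \<and>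
        conditional_limit M X Y
          (\<lambda>x. w\<^sub>l / (1 - w\<^sub>l) * x)
          (\<lambda>x. x powr ((t + 1) / (t + 2)) * L (x powr (- 1 / (t + 2))) powr (- 1 / (t + 2)))
          (cdf \<mu>)))
     \<and>
     (measure H {w\<^sub>l} > 0 \<longrightarrow>
      (\<exists>\<mu>. real_distribution \<mu> \<and> nondegenerate \<mu> \<and>
        (\<forall>z>0. cdf \<mu> z =
           1 - (1 - w\<^sub>l * measure H {w\<^sub>l}) * exp (- ((1 - w\<^sub>l) * measure H {w\<^sub>l} * z))) \<and>
        (\<forall>z<0. cdf \<mu> z = 0) \<and>
        measure \<mu> {0} = w\<^sub>l * measure H {w\<^sub>l} \<and>
        conditional_limit M X Y (\<lambda>x. w\<^sub>l / (1 - w\<^sub>l) * x) (\<lambda>x. 1) (cdf \<mu>)))"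
proof (intro conjI impI)
  have w\<^sub>l: "0 \<le> w\<^sub>l" "w\<^sub>l < 1 / 2" "w\<^sub>l < w\<^sub>u" "w\<^sub>l < 1"
    using assms(6,7) by auto
  note ratio = density_ratio_at_edge[OF assms(10,11)]
  {
    assume no_atom: "measure H {w\<^sub>l} = 0"
      and meas: "\<exists>\<delta>>0. L \<in> borel_measurable (restrict_space borel {0<..<\<delta>})"
      and shift: "\<forall>\<tau>\<in>{0<..<1}. ((\<lambda>w. L (w * L w powr (- \<tau>)) / L w) \<longlongrightarrow> 1) (at_right 0)"
    obtain \<delta> where \<delta>: "\<delta> > 0" "L \<in> borel_measurable (restrict_space borel {0<..<\<delta>})"
      using meas by blast
    have shift': "((\<lambda>w. L (w * L w powr (- (1 / (t + 2)))) / L w) \<longlongrightarrow> 1) (at_right 0)"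
      using shift \<open>t > -1\<close> by auto
    define \<rho> where "\<rho> = (\<lambda>z. (1 - w\<^sub>l) powr (3 + 2 * t) * z powr (t + 2) / ((t + 1) * (t + 2)))"
    have top: "filterlim \<rho> at_top at_top"
    proof -
      define C where "C = (1 - w\<^sub>l) powr (3 + 2 * t) / ((t + 1) * (t + 2))"
      have "C > 0" using w\<^sub>l \<open>t > -1\<close> by (simp add: C_def)
      have "filterlim (\<lambda>z. z powr (t + 2)) at_top at_top"
        using \<open>t > -1\<close> by real_asymp
      hence "filterlim (\<lambda>z. C * z powr (t + 2)) at_top at_top"
        using \<open>C > 0\<close> by (intro filterlim_tendsto_pos_mult_at_top[OF tendsto_const])
      thus ?thesis by (simp add: C_def \<rho>_def)
    qed
    obtain \<mu> where \<mu>: "real_distribution \<mu>" "nondegenerate \<mu>"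
      "cdf \<mu> = (\<lambda>z. if z < 0 then 0 else 1 - 1 * exp (- \<rho> z))"
    proof (rule exponential_cdf_exists[of 1 \<rho>])
      show "continuous_on {0..} \<rho>"
        unfolding \<rho>_def using \<open>t > -1\<close>
        by (intro continuous_on_divide continuous_on_mult continuous_on_const continuous_on_powr' continuous_on_id) auto
      show "\<rho> z \<le> \<rho> z'" if "0 \<le> z" "z \<le> z'" for z z'
        unfolding \<rho>_def using that \<open>t > -1\<close>
        by (intro divide_right_mono mult_left_mono powr_mono2) auto
      show "\<rho> 0 = 0" using \<open>t > -1\<close> by (simp add: \<rho>_def)
    qed (use top in auto)
    obtain b where b: "b \<in> borel_measurable borel" "\<forall>\<^sub>F x in at_top. b x = norming L t x"
      using norming_borel_modification[OF \<delta>(2,1) \<open>t > -1\<close>] .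
    have "conditional_limit M X Y (\<lambda>x. w\<^sub>l / (1 - w\<^sub>l) * x) b (cdf \<mu>)"
    proof (rule conditional_limit_from_strips[OF assms(1-3) _ b(1)])
      show "\<forall>\<^sub>F x in at_top. b x > 0"
        using b(2) norming_pos[OF assms(10) \<delta>(2,1) \<open>t > -1\<close>] by eventually_elim simp
      fix z :: real assume "z \<noteq> 0"
      have "1 - cdf \<mu> z = (if z < 0 then 1 else exp (- \<rho> z))"
        by (simp add: \<mu>(3))
      thus "strip_approximable H (\<lambda>x. w\<^sub>l / (1 - w\<^sub>l) * x + z * b x) (1 - cdf \<mu> z)"
        using strip_approximable_regular[OF assms(10) \<delta>(2,1) \<open>t > -1\<close> assms(2,4) w\<^sub>l(1-3) no_atom
            assms(8) ratio shift' b(2) \<open>z \<noteq> 0\<close>]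
        unfolding \<rho>_def by (simp only:)
    qed simp
    hence "conditional_limit M X Y (\<lambda>x. w\<^sub>l / (1 - w\<^sub>l) * x) (norming L t) (cdf \<mu>)"
      using conditional_limit_cong[OF always_eventually[OF allI[OF refl]] b(2)] by blast
    moreover have "norming L t =
        (\<lambda>x. x powr ((t + 1) / (t + 2)) * L (x powr (- 1 / (t + 2))) powr (- 1 / (t + 2)))"
      by (simp add: norming_def norming_arg_def fun_eq_iff)
    ultimately show "\<exists>\<mu>. real_distribution \<mu> \<and> nondegenerate \<mu> \<and>
        (\<forall>z>0. cdf \<mu> z =
           1 - exp (- ((1 - w\<^sub>l) powr (3 + 2 * t) * z powr (t + 2) / ((t + 1) * (t + 2))))) \<and>
        conditional_limit M X Y
          (\<lambda>x. w\<^sub>l / (1 - w\<^sub>l) * x)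
          (\<lambda>x. x powr ((t + 1) / (t + 2)) * L (x powr (- 1 / (t + 2))) powr (- 1 / (t + 2)))
          (cdf \<mu>)"
      using \<mu> by (intro exI[of _ \<mu>]) (auto simp: \<rho>_def)
  }
  {
    assume atom: "measure H {w\<^sub>l} > 0"
    define p where "p = measure H {w\<^sub>l}"
    interpret H: finite_measure H by (rule spectral_measureD[OF assms(2)])
    have "p \<le> 2"
      using H.bounded_measure[of "{w\<^sub>l}"] spectral_measureD(3,5)[OF assms(2)] by (simp add: p_def)
    \<comment> \<open>The bound \<open>w\<^sub>l < 1 / 2\<close> keeps the atom of the limit at \<open>0\<close> below full mass.\<close>
    have "w\<^sub>l * p < 1"
    proof -
      have "w\<^sub>l * p < 1 / 2 * p" using w\<^sub>l(2) atom by (intro mult_strict_right_mono) (auto simp: p_def)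
      thus ?thesis using \<open>p \<le> 2\<close> by simp
    qed
    have "(1 - w\<^sub>l) * p > 0" using w\<^sub>l atom by (simp add: p_def)
    have top: "filterlim (\<lambda>z. (1 - w\<^sub>l) * p * z) at_top at_top"
      using \<open>(1 - w\<^sub>l) * p > 0\<close> by (rule filterlim_tendsto_pos_mult_at_top[OF tendsto_const _ filterlim_ident])
    obtain \<mu> where \<mu>: "real_distribution \<mu>" "nondegenerate \<mu>"
      "cdf \<mu> = (\<lambda>z. if z < 0 then 0 else 1 - (1 - w\<^sub>l * p) * exp (- ((1 - w\<^sub>l) * p * z)))"
      "measure \<mu> {0} = 1 - (1 - w\<^sub>l * p)"
    proof (rule exponential_cdf_exists[of "1 - w\<^sub>l * p" "\<lambda>z. (1 - w\<^sub>l) * p * z"])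
      show "0 < 1 - w\<^sub>l * p" using \<open>w\<^sub>l * p < 1\<close> by simp
      show "1 - w\<^sub>l * p \<le> 1" using w\<^sub>l by (simp add: p_def)
      show "continuous_on {0..} (\<lambda>z. (1 - w\<^sub>l) * p * z)" by (intro continuous_intros)
      show "(1 - w\<^sub>l) * p * z \<le> (1 - w\<^sub>l) * p * z'" if "0 \<le> z" "z \<le> z'" for z z'
        using that \<open>(1 - w\<^sub>l) * p > 0\<close> by (intro mult_left_mono) auto
    qed (use top in auto)
    have "conditional_limit M X Y (\<lambda>x. w\<^sub>l / (1 - w\<^sub>l) * x) (\<lambda>x. 1) (cdf \<mu>)"
    proof (rule conditional_limit_from_strips[OF assms(1-3)])
      fix z :: real assume "z \<noteq> 0"
      have "1 - cdf \<mu> z = (if z < 0 then 1 else (1 - w\<^sub>l * p) * exp (- ((1 - w\<^sub>l) * p * z)))"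
        by (simp add: \<mu>(3))
      thus "strip_approximable H (\<lambda>x. w\<^sub>l / (1 - w\<^sub>l) * x + z * 1) (1 - cdf \<mu> z)"
        using strip_approximable_atom[OF assms(2,4) w\<^sub>l(1,2) \<open>z \<noteq> 0\<close>] by (simp only: p_def)
    qed auto
    with \<mu> show "\<exists>\<mu>. real_distribution \<mu> \<and> nondegenerate \<mu> \<and>
        (\<forall>z>0. cdf \<mu> z =
           1 - (1 - w\<^sub>l * measure H {w\<^sub>l}) * exp (- ((1 - w\<^sub>l) * measure H {w\<^sub>l} * z))) \<and>
        (\<forall>z<0. cdf \<mu> z = 0) \<and>
        measure \<mu> {0} = w\<^sub>l * measure H {w\<^sub>l} \<and>
        conditional_limit M X Y (\<lambda>x. w\<^sub>l / (1 - w\<^sub>l) * x) (\<lambda>x. 1) (cdf \<mu>)"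
      unfolding p_def by (intro exI[of _ \<mu>]) auto
  }
qed

end
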